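(* For every positive integer $n$, the categories $\mathcal{B}oole_n$ and $\mathcal{S}tone_n$ are dual to each other.
   Context: $\mathcal{B}oole_n$: objects are pairs $\langle B,(J_i)_{i=1}^{n-1}\rangle$ with $B$ a Boolean algebra and $J_1,\dots,J_{n-1}$ ideals of $B$ such that (i) $J_i=J_{n-i}$ for all $i=1,\dots,n-1$ and (ii) $J_h\cap J_{i-h}\subseteq J_i$ for all $i=2,\dots,n-1$ and $h=1,\dots,i-1$. A morphism $\langle B,(J_i)\rangle\to\langle B',(J'_i)\rangle$ is a Boolean algebra homomorphism $f:B\to B'$ with $f[J_i]\subseteq J'_i$ for all $i$. $\mathcal{T}op_n$: objects are pairs $\langle\langle X,\Omega\rangle,(o_i)_{i=1}^{n-1}\rangle$ with $\langle X,\Omega\rangle$ a topological space and $o_1,\dots,o_{n-1}$ open subsets of $X$ such that (i) $o_i=o_{n-i}$ for all $i$ and (ii) $o_h\cap o_{i-h}\subseteq o_i$ for all $i=2,\dots,n-1$, $h=1,\dots,i-1$. A morphism $\langle\langle X,\Omega\rangle,(o_i)\rangle\to\langle\langle X',\Omega'\rangle,(o'_i)\rangle$ is a continuous map $f:X\to X'$ with $f^{-1}[o'_i]\subseteq o_i$ for all $i$. $\mathcal{S}tone_n$ is the full subcategory of $\mathcal{T}op_n$ of objects whose underlying space is a Stone space (compact, Hausdorff, zero-dimensional). *)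

theory Defs
  imports "HOL-Analysis.Analysis" "HOL-Library.Equipollence"
begin

section \<open>Categories, functors, duality\<close>

text \<open>Hom-sets are indexed by source and target and need not be disjoint;
  accordingly composition (\<open>Comp C X Y Z g f\<close> is \<open>g\<close> after \<open>f\<close>, for \<open>f : X \<rightarrow> Y\<close> and
  \<open>g : Y \<rightarrow> Z\<close>) and the arrow part of a functor carry the objects as arguments.\<close>

record ('o, 'm) cat =
  Ob :: "'o set"
  Hom :: "'o \<Rightarrow> 'o \<Rightarrow> 'm set"
  Id :: "'o \<Rightarrow> 'm"
  Comp :: "'o \<Rightarrow> 'o \<Rightarrow> 'o \<Rightarrow> 'm \<Rightarrow> 'm \<Rightarrow> 'm"

definition category :: "('o, 'm) cat \<Rightarrow> bool" where
  "category C \<longleftrightarrow>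
     (\<forall>X\<in>Ob C. Id C X \<in> Hom C X X) \<and>
     (\<forall>X\<in>Ob C. \<forall>Y\<in>Ob C. \<forall>Z\<in>Ob C. \<forall>f\<in>Hom C X Y. \<forall>g\<in>Hom C Y Z.
        Comp C X Y Z g f \<in> Hom C X Z) \<and>
     (\<forall>X\<in>Ob C. \<forall>Y\<in>Ob C. \<forall>f\<in>Hom C X Y.
        Comp C X X Y f (Id C X) = f \<and> Comp C X Y Y (Id C Y) f = f) \<and>
     (\<forall>W\<in>Ob C. \<forall>X\<in>Ob C. \<forall>Y\<in>Ob C. \<forall>Z\<in>Ob C.
        \<forall>f\<in>Hom C W X. \<forall>g\<in>Hom C X Y. \<forall>h\<in>Hom C Y Z.
        Comp C W X Z (Comp C X Y Z h g) f = Comp C W Y Z h (Comp C W X Y g f))"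

definition full_subcategory :: "('o, 'm) cat \<Rightarrow> ('o \<Rightarrow> bool) \<Rightarrow> ('o, 'm) cat" where
  "full_subcategory C P = C\<lparr>Ob := {X \<in> Ob C. P X}\<rparr>"

definition opposite :: "('o, 'm) cat \<Rightarrow> ('o, 'm) cat" where
  "opposite C =
     \<lparr>Ob = Ob C, Hom = (\<lambda>X Y. Hom C Y X), Id = Id C, Comp = (\<lambda>X Y Z g f. Comp C Z Y X f g)\<rparr>"

type_synonym ('o, 'm, 'p, 'q) functor_data = "('o \<Rightarrow> 'p) \<times> ('o \<Rightarrow> 'o \<Rightarrow> 'm \<Rightarrow> 'q)"

definition is_functor ::
  "('o, 'm) cat \<Rightarrow> ('p, 'q) cat \<Rightarrow> ('o, 'm, 'p, 'q) functor_data \<Rightarrow> bool" where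
  "is_functor C D = (\<lambda>(F, F').
     (\<forall>X\<in>Ob C. F X \<in> Ob D) \<and>
     (\<forall>X\<in>Ob C. \<forall>Y\<in>Ob C. \<forall>f\<in>Hom C X Y. F' X Y f \<in> Hom D (F X) (F Y)) \<and>
     (\<forall>X\<in>Ob C. F' X X (Id C X) = Id D (F X)) \<and>
     (\<forall>X\<in>Ob C. \<forall>Y\<in>Ob C. \<forall>Z\<in>Ob C. \<forall>f\<in>Hom C X Y. \<forall>g\<in>Hom C Y Z.
        F' X Z (Comp C X Y Z g f) = Comp D (F X) (F Y) (F Z) (F' Y Z g) (F' X Y f)))"

definition id_functor :: "('o, 'm, 'o, 'm) functor_data" where
  "id_functor = (\<lambda>X. X, \<lambda>X Y f. f)"

definition comp_functor ::
  "('p, 'q, 'r, 's) functor_data \<Rightarrow> ('o, 'm, 'p, 'q) functor_data \<Rightarrow> ('o, 'm, 'r, 's) functor_data"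
  where "comp_functor = (\<lambda>(G, G') (F, F'). (\<lambda>X. G (F X), \<lambda>X Y f. G' (F X) (F Y) (F' X Y f)))"

definition is_iso :: "('o, 'm) cat \<Rightarrow> 'o \<Rightarrow> 'o \<Rightarrow> 'm \<Rightarrow> bool" where
  "is_iso C X Y f \<longleftrightarrow> f \<in> Hom C X Y \<and>
     (\<exists>g\<in>Hom C Y X. Comp C X Y X g f = Id C X \<and> Comp C Y X Y f g = Id C Y)"

definition naturally_isomorphic ::
  "('o, 'm) cat \<Rightarrow> ('p, 'q) cat \<Rightarrow>
    ('o, 'm, 'p, 'q) functor_data \<Rightarrow> ('o, 'm, 'p, 'q) functor_data \<Rightarrow> bool" where
  "naturally_isomorphic C D = (\<lambda>(F, F') (G, G'). \<exists>\<eta>.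
     (\<forall>X\<in>Ob C. is_iso D (F X) (G X) (\<eta> X)) \<and>
     (\<forall>X\<in>Ob C. \<forall>Y\<in>Ob C. \<forall>f\<in>Hom C X Y.
        Comp D (F X) (F Y) (G Y) (\<eta> Y) (F' X Y f) = Comp D (F X) (G X) (G Y) (G' X Y f) (\<eta> X)))"

definition equivalent_categories :: "('o, 'm) cat \<Rightarrow> ('p, 'q) cat \<Rightarrow> bool" where
  "equivalent_categories C D \<longleftrightarrow> category C \<and> category D \<and>
     (\<exists>F G. is_functor C D F \<and> is_functor D C G \<and>
        naturally_isomorphic C C id_functor (comp_functor G F) \<and>
        naturally_isomorphic D D id_functor (comp_functor F G))"

definition dual_categories :: "('o, 'm) cat \<Rightarrow> ('p, 'q) cat \<Rightarrow> bool" where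
  "dual_categories C D \<longleftrightarrow> equivalent_categories C (opposite D)"


section \<open>Boolean algebras with ideals\<close>

record 'a ba =
  car :: "'a set"
  join :: "'a \<Rightarrow> 'a \<Rightarrow> 'a"
  meet :: "'a \<Rightarrow> 'a \<Rightarrow> 'a"
  cmp :: "'a \<Rightarrow> 'a"
  zer :: "'a"
  unt :: "'a"

text \<open>The one-element algebra is allowed; it is dual to the empty space.\<close>

definition boolean_alg :: "'a ba \<Rightarrow> bool" where
  "boolean_alg B \<longleftrightarrow>
     zer B \<in> car B \<and> unt B \<in> car B \<and>
     (\<forall>x\<in>car B. cmp B x \<in> car B) \<and>
     (\<forall>x\<in>car B. \<forall>y\<in>car B. join B x y \<in> car B \<and> meet B x y \<in> car B) \<and>
     (\<forall>x\<in>car B. \<forall>y\<in>car B. \<forall>z\<in>car B.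
        join B (join B x y) z = join B x (join B y z) \<and>
        meet B (meet B x y) z = meet B x (meet B y z)) \<and>
     (\<forall>x\<in>car B. \<forall>y\<in>car B. join B x y = join B y x \<and> meet B x y = meet B y x) \<and>
     (\<forall>x\<in>car B. \<forall>y\<in>car B. \<forall>z\<in>car B.
        meet B x (join B y z) = join B (meet B x y) (meet B x z) \<and>
        join B x (meet B y z) = meet B (join B x y) (join B x z)) \<and>
     (\<forall>x\<in>car B. join B x (zer B) = x \<and> meet B x (unt B) = x) \<and>
     (\<forall>x\<in>car B. join B x (cmp B x) = unt B \<and> meet B x (cmp B x) = zer B)"

text \<open>The improper ideal \<open>car B\<close> is allowed.\<close>

definition ba_ideal :: "'a ba \<Rightarrow> 'a set \<Rightarrow> bool" where
  "ba_ideal B I \<longleftrightarrow> I \<subseteq> car B \<and> zer B \<in> I \<and>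
     (\<forall>x\<in>I. \<forall>y\<in>I. join B x y \<in> I) \<and> (\<forall>x\<in>I. \<forall>y\<in>car B. meet B x y \<in> I)"

definition ba_hom :: "'a ba \<Rightarrow> 'b ba \<Rightarrow> ('a \<Rightarrow> 'b) set" where
  "ba_hom A B = {f \<in> car A \<rightarrow>\<^sub>E car B.
     f (zer A) = zer B \<and> f (unt A) = unt B \<and>
     (\<forall>x\<in>car A. f (cmp A x) = cmp B (f x)) \<and>
     (\<forall>x\<in>car A. \<forall>y\<in>car A.
        f (join A x y) = join B (f x) (f y) \<and> f (meet A x y) = meet B (f x) (f y))}"

text \<open>The values \<open>J i\<close> with \<open>i\<close> outside \<open>{1..<n}\<close> are not part of the structure.\<close>

type_synonym 'a boole = "'a ba \<times> (nat \<Rightarrow> 'a set)"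

definition boole_ob :: "nat \<Rightarrow> 'a boole \<Rightarrow> bool" where
  "boole_ob n = (\<lambda>(B, J). boolean_alg B \<and>
     (\<forall>i\<in>{1..<n}. ba_ideal B (J i)) \<and>
     (\<forall>i\<in>{1..<n}. J i = J (n - i)) \<and>
     (\<forall>i\<in>{2..<n}. \<forall>h\<in>{1..<i}. J h \<inter> J (i - h) \<subseteq> J i))"

definition boole_hom :: "nat \<Rightarrow> 'a boole \<Rightarrow> 'b boole \<Rightarrow> ('a \<Rightarrow> 'b) set" where
  "boole_hom n = (\<lambda>(A, I) (B, J). {f \<in> ba_hom A B. \<forall>i\<in>{1..<n}. f ` I i \<subseteq> J i})"

definition boole_id :: "'a boole \<Rightarrow> 'a \<Rightarrow> 'a" where
  "boole_id A = (\<lambda>x\<in>car (fst A). x)"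

definition boole_comp :: "'a boole \<Rightarrow> ('b \<Rightarrow> 'c) \<Rightarrow> ('a \<Rightarrow> 'b) \<Rightarrow> 'a \<Rightarrow> 'c" where
  "boole_comp A g f = compose (car (fst A)) g f"

definition boole_iso :: "nat \<Rightarrow> 'a boole \<Rightarrow> 'b boole \<Rightarrow> ('a \<Rightarrow> 'b) \<Rightarrow> bool" where
  "boole_iso n A B f \<longleftrightarrow> f \<in> boole_hom n A B \<and>
     (\<exists>g\<in>boole_hom n B A. boole_comp A g f = boole_id A \<and> boole_comp B f g = boole_id B)"


section \<open>Topological spaces with open subsets\<close>

type_synonym 'x topn = "'x topology \<times> (nat \<Rightarrow> 'x set)"

definition top_ob :: "nat \<Rightarrow> 'x topn \<Rightarrow> bool" where
  "top_ob n = (\<lambda>(X, u).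
     (\<forall>i\<in>{1..<n}. openin X (u i)) \<and>
     (\<forall>i\<in>{1..<n}. u i = u (n - i)) \<and>
     (\<forall>i\<in>{2..<n}. \<forall>h\<in>{1..<i}. u h \<inter> u (i - h) \<subseteq> u i))"

definition top_hom :: "nat \<Rightarrow> 'x topn \<Rightarrow> 'y topn \<Rightarrow> ('x \<Rightarrow> 'y) set" where
  "top_hom n = (\<lambda>(X, u) (Y, v).
     {f \<in> topspace X \<rightarrow>\<^sub>E topspace Y. continuous_map X Y f \<and>
        (\<forall>i\<in>{1..<n}. {x \<in> topspace X. f x \<in> v i} \<subseteq> u i)})"

definition top_id :: "'x topn \<Rightarrow> 'x \<Rightarrow> 'x" where
  "top_id X = (\<lambda>x\<in>topspace (fst X). x)"

definition top_comp :: "'x topn \<Rightarrow> ('y \<Rightarrow> 'z) \<Rightarrow> ('x \<Rightarrow> 'y) \<Rightarrow> 'x \<Rightarrow> 'z" where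
  "top_comp X g f = compose (topspace (fst X)) g f"

definition top_iso :: "nat \<Rightarrow> 'x topn \<Rightarrow> 'y topn \<Rightarrow> ('x \<Rightarrow> 'y) \<Rightarrow> bool" where
  "top_iso n X Y f \<longleftrightarrow> f \<in> top_hom n X Y \<and>
     (\<exists>g\<in>top_hom n Y X. top_comp X g f = top_id X \<and> top_comp Y f g = top_id Y)"

definition clopens :: "'x topology \<Rightarrow> 'x set set" where
  "clopens X = {V. openin X V \<and> closedin X V}"

definition stone_space :: "'x topology \<Rightarrow> bool" where
  "stone_space X \<longleftrightarrow> compact_space X \<and> Hausdorff_space X \<and>
     neighbourhood_base_of (\<lambda>V. V \<in> clopens X) X"

definition stone_ob :: "nat \<Rightarrow> 'x topn \<Rightarrow> bool" where
  "stone_ob n X \<longleftrightarrow> top_ob n X \<and> stone_space (fst X)"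


section \<open>The categories relative to a universe of small sets\<close>

text \<open>A carrier lives in a HOL type, and the dual of a structure on \<open>'a\<close> lives on \<open>'a set\<close>.
  To have both categories over one type, structures are restricted to small carriers,
  where small sets are closed under subsets and, up to bijection, under power sets.\<close>

definition universe :: "'u set set \<Rightarrow> bool" where
  "universe U \<longleftrightarrow> (\<forall>A\<in>U. \<forall>B. B \<subseteq> A \<longrightarrow> B \<in> U) \<and> (\<forall>A\<in>U. \<exists>B\<in>U. Pow A \<approx> B)"

definition Boole_cat :: "nat \<Rightarrow> 'u set set \<Rightarrow> ('u boole, 'u \<Rightarrow> 'u) cat" where
  "Boole_cat n U =
     \<lparr>Ob = {A. boole_ob n A \<and> car (fst A) \<in> U}, Hom = boole_hom n, Id = boole_id,
      Comp = (\<lambda>A B C. boole_comp A)\<rparr>"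

definition Top_cat :: "nat \<Rightarrow> 'u set set \<Rightarrow> ('u topn, 'u \<Rightarrow> 'u) cat" where
  "Top_cat n U =
     \<lparr>Ob = {X. top_ob n X \<and> topspace (fst X) \<in> U}, Hom = top_hom n, Id = top_id,
      Comp = (\<lambda>X Y Z. top_comp X)\<rparr>"

definition Stone_cat :: "nat \<Rightarrow> 'u set set \<Rightarrow> ('u topn, 'u \<Rightarrow> 'u) cat" where
  "Stone_cat n U = full_subcategory (Top_cat n U) (\<lambda>X. stone_space (fst X))"


section \<open>The Stone functors, between arbitrary types\<close>

definition ultrafilters :: "'a ba \<Rightarrow> 'a set set" where
  "ultrafilters B = {F. F \<subseteq> car B \<and> unt B \<in> F \<and> zer B \<notin> F \<and>
     (\<forall>x\<in>F. \<forall>y\<in>F. meet B x y \<in> F) \<and> (\<forall>x\<in>F. \<forall>y\<in>car B. join B x y \<in> F) \<and>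
     (\<forall>x\<in>car B. x \<in> F \<or> cmp B x \<in> F)}"

definition spec :: "'a boole \<Rightarrow> 'a set topn" where
  "spec = (\<lambda>(B, J).
     (topology_generated_by ((\<lambda>a. {F \<in> ultrafilters B. a \<in> F}) ` car B),
      \<lambda>i. {F \<in> ultrafilters B. F \<inter> J i \<noteq> {}}))"

definition spec_map :: "'a boole \<Rightarrow> 'b boole \<Rightarrow> ('a \<Rightarrow> 'b) \<Rightarrow> 'b set \<Rightarrow> 'a set" where
  "spec_map A B f = (\<lambda>F\<in>ultrafilters (fst B). {a \<in> car (fst A). f a \<in> F})"

definition clop :: "'x topn \<Rightarrow> 'x set boole" where
  "clop = (\<lambda>(X, u).
     (\<lparr>car = clopens X, join = (\<union>), meet = (\<inter>), cmp = (\<lambda>V. topspace X - V),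
       zer = {}, unt = topspace X\<rparr>,
      \<lambda>i. {V \<in> clopens X. V \<subseteq> u i}))"

definition clop_map :: "'x topn \<Rightarrow> 'y topn \<Rightarrow> ('x \<Rightarrow> 'y) \<Rightarrow> 'y set \<Rightarrow> 'x set" where
  "clop_map X Y g = (\<lambda>V\<in>clopens (fst Y). {x \<in> topspace (fst X). g x \<in> V})"

definition boole_unit :: "'a boole \<Rightarrow> 'a \<Rightarrow> 'a set set" where
  "boole_unit A = (\<lambda>a\<in>car (fst A). {F \<in> ultrafilters (fst A). a \<in> F})"

definition stone_unit :: "'x topn \<Rightarrow> 'x \<Rightarrow> 'x set set" where
  "stone_unit X = (\<lambda>x\<in>topspace (fst X). {V \<in> clopens (fst X). x \<in> V})"

end

theory Submission
  imports Defs
begin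

text \<open>
  The duality rests on the prime ideal theorem: an ideal not containing an element \<open>a\<close> is avoided by
  an ultrafilter containing \<open>a\<close>. It makes \<open>a \<mapsto> {F. a \<in> F}\<close> an isomorphism onto the clopen sets of the
  spectrum, and it identifies an ideal \<open>J\<close> with the set of clopens inside the open set
  \<open>{F. F \<inter> J \<noteq> {}}\<close>; conversely an open set of a Stone space is the union of the clopens inside it.
  For the categories over a universe, the spectrum and the clopen algebra are moved back along
  injections into small sets, and the equivalence is read off the pairs of objects \<open>A\<close>, \<open>X\<close> with a
  chosen isomorphism of \<open>A\<close> with the clopen algebra of \<open>X\<close>, since \<open>X \<mapsto> clop X\<close> is fully faithful.
\<close>

section \<open>Boolean algebras and ultrafilters\<close>

text \<open>Two obstacles shape the proof. In the topology of the spectrum, three facts say that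
  something finite suffices: compactness, the description of the clopen sets, and the recovery of an
  ideal from its open set. The first two are reduced to one pattern: the elements \<open>a\<close>
  whose Stone set has the wanted property form an ideal that every ultrafilter meets, so the ideal
  contains the unit, and the property holds for the whole space. The second obstacle is typing. The
  spectrum of an algebra over \<open>'u\<close> has points of type \<open>'u set\<close>, so over a
  universe each object needs its own chosen copy on a small set. The choices for different objects
  are unrelated, and functor laws proved by conjugating with them would be unwieldy. Keeping all
  possible choices as indices turns every such law into a uniqueness statement about related arrows.
  Condition (ii) crosses the duality through a single fact: if \<open>a\<close> and \<open>b\<close>
  lie in an ultrafilter, so does their meet, and the meet lies in every ideal containing
  \<open>a\<close> or \<open>b\<close>.\<close>

context
  fixes B :: "'a ba"
  assumes B: "boolean_alg B"
begin

lemma ba_closed: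
  "zer B \<in> car B" "unt B \<in> car B"
  "x \<in> car B \<Longrightarrow> cmp B x \<in> car B"
  "x \<in> car B \<Longrightarrow> y \<in> car B \<Longrightarrow> join B x y \<in> car B"
  "x \<in> car B \<Longrightarrow> y \<in> car B \<Longrightarrow> meet B x y \<in> car B"
  using B unfolding boolean_alg_def by blast+

lemma ba_commute:
  assumes "x \<in> car B" "y \<in> car B"
  shows "join B x y = join B y x" "meet B x y = meet B y x"
  using B assms unfolding boolean_alg_def by blast+

lemma ba_assoc:
  assumes "x \<in> car B" "y \<in> car B" "z \<in> car B"
  shows "join B (join B x y) z = join B x (join B y z)"
    "meet B (meet B x y) z = meet B x (meet B y z)"
  using B assms unfolding boolean_alg_def by blast+

lemma ba_distrib:
  assumes "x \<in> car B" "y \<in> car B" "z \<in> car B"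
  shows "meet B x (join B y z) = join B (meet B x y) (meet B x z)"
    "join B x (meet B y z) = meet B (join B x y) (join B x z)"
  using B assms unfolding boolean_alg_def by blast+

lemma ba_neutral:
  assumes "x \<in> car B"
  shows "join B x (zer B) = x" "meet B x (unt B) = x"
    "join B x (cmp B x) = unt B" "meet B x (cmp B x) = zer B"
  using B assms unfolding boolean_alg_def by blast+

text \<open>Idempotence is not an axiom of \<open>boolean_alg\<close>. It comes from distributing
  \<open>x\<close> over \<open>join B x (cmp B x)\<close>, which is the unit, and from the dual
  computation.\<close>

lemma ba_idem:
  assumes "x \<in> car B"
  shows "join B x x = x" "meet B x x = x"
  using ba_distrib[of x x "cmp B x"] ba_neutral[of x] ba_neutral[of "meet B x x"]
    ba_neutral[of "join B x x"] ba_closed assms by simp_all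

lemma ba_absorbing:
  assumes "x \<in> car B"
  shows "join B x (unt B) = unt B" "meet B x (zer B) = zer B"
  using ba_assoc[of x x "cmp B x"] ba_neutral[of x] ba_idem[of x] ba_closed assms by simp_all

lemma ba_absorb:
  assumes "x \<in> car B" "y \<in> car B"
  shows "join B x (meet B x y) = x" "meet B x (join B x y) = x"
proof -
  show "join B x (meet B x y) = x"
    using ba_distrib(1)[of x "unt B" y] ba_neutral[of x] ba_absorbing[of y] ba_commute[of y "unt B"]
      ba_closed assms by simp
  then show "meet B x (join B x y) = x"
    using ba_distrib(1)[of x x y] ba_idem[of x] assms by simp
qed

lemma ba_ideal_zero: "ba_ideal B {zer B}"
  using ba_closed ba_idem[of "zer B"] ba_absorbing(2) ba_commute(2)[of "zer B"]
  by (simp add: ba_ideal_def)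

section \<open>Ideals and the prime ideal theorem\<close>

lemma ba_ideal_quotient:
  assumes M: "ba_ideal B M" and x: "x \<in> car B"
  shows "ba_ideal B {y \<in> car B. meet B x y \<in> M}" "M \<subseteq> {y \<in> car B. meet B x y \<in> M}"
proof -
  show "ba_ideal B {y \<in> car B. meet B x y \<in> M}"
    using M x ba_closed ba_distrib(1)[of x] ba_absorbing[of x] ba_assoc(2)[of x, symmetric]
    by (auto simp: ba_ideal_def)
  show "M \<subseteq> {y \<in> car B. meet B x y \<in> M}"
    using M x ba_commute(2)[of x] by (auto simp: ba_ideal_def)
qed

text \<open>Zorn's lemma is applied to the ideals that miss \<open>a\<close>, not to all proper
  ideals, so that the complement of \<open>M\<close> is sure to contain the prescribed element
  \<open>a\<close>. Chains are bounded by their unions, since any two elements of the union already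
  lie in one member.\<close>

lemma ex_maximal_ideal_avoiding:
  assumes J: "ba_ideal B J" and a: "a \<notin> J"
  obtains M where "ba_ideal B M" "J \<subseteq> M" "a \<notin> M"
    "\<And>I. ba_ideal B I \<Longrightarrow> M \<subseteq> I \<Longrightarrow> a \<notin> I \<Longrightarrow> I = M"
proof -
  let ?S = "{I. ba_ideal B I \<and> J \<subseteq> I \<and> a \<notin> I}"
  have "\<exists>M\<in>?S. \<forall>I\<in>?S. M \<subseteq> I \<longrightarrow> I = M"
  proof (rule subset_Zorn_nonempty)
    show "?S \<noteq> {}"
      using J a by blast
    fix C assume C: "C \<noteq> {}" "subset.chain ?S C"
    then have id: "\<And>I. I \<in> C \<Longrightarrow> ba_ideal B I \<and> J \<subseteq> I \<and> a \<notin> I"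
      and lin: "\<And>I K. I \<in> C \<Longrightarrow> K \<in> C \<Longrightarrow> I \<subseteq> K \<or> K \<subseteq> I"
      by (auto simp: subset_chain_def)
    have "join B x y \<in> \<Union>C" if "x \<in> \<Union>C" "y \<in> \<Union>C" for x y
    proof -
      from that obtain I where "I \<in> C" "x \<in> I" "y \<in> I"
        using lin by blast
      then show ?thesis
        using id[of I] unfolding ba_ideal_def by blast
    qed
    moreover have "zer B \<in> \<Union>C"
      using C(1) id by (force simp: ba_ideal_def)
    moreover have "\<Union>C \<subseteq> car B" "\<forall>x\<in>\<Union>C. \<forall>y\<in>car B. meet B x y \<in> \<Union>C"
      using id unfolding ba_ideal_def by blast+
    ultimately have "ba_ideal B (\<Union>C)"
      unfolding ba_ideal_def by blast
    then show "\<Union>C \<in> ?S"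
      using C(1) id by blast
  qed
  then obtain M where "M \<in> ?S" "\<forall>I\<in>?S. M \<subseteq> I \<longrightarrow> I = M" ..
  then show ?thesis
    by (intro that[of M]) auto
qed

text \<open>The complement of an ideal maximal among those that avoid a point is an ultrafilter:
  for \<open>x\<close> outside \<open>M\<close>, maximality is applied to the quotient \<open>{y. x \<and> y \<in> M}\<close>.\<close>

lemma ex_ultrafilter_avoiding:
  assumes J: "ba_ideal B J" and a: "a \<in> car B" "a \<notin> J"
  obtains F where "F \<in> ultrafilters B" "a \<in> F" "F \<inter> J = {}"
proof -
  obtain M where M: "ba_ideal B M" "J \<subseteq> M" "a \<notin> M"
    and max: "\<And>I. ba_ideal B I \<Longrightarrow> M \<subseteq> I \<Longrightarrow> a \<notin> I \<Longrightarrow> I = M"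
    using ex_maximal_ideal_avoiding[OF J a(2)] by blast
  have sub: "M \<subseteq> car B" and zer: "zer B \<in> M"
    and joinM: "\<And>x y. x \<in> M \<Longrightarrow> y \<in> M \<Longrightarrow> join B x y \<in> M"
    and meetM: "\<And>x y. x \<in> M \<Longrightarrow> y \<in> car B \<Longrightarrow> meet B x y \<in> M"
    using M(1) by (auto simp: ba_ideal_def)
  have unt: "unt B \<notin> M"
    using meetM[of "unt B" a] a(1) M(3) ba_commute[of a "unt B"] ba_neutral[of a] ba_closed by auto
  \<comment> \<open>\<open>y\<close> lies in the quotient of \<open>M\<close> by \<open>x\<close>
    but not in \<open>M\<close>, so the quotient is a strictly larger ideal. By maximality it
    contains \<open>a\<close>.\<close>
  have max': "meet B x a \<in> M" if "x \<in> car B" "y \<in> car B" "y \<notin> M" "meet B x y \<in> M" for x y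
    using max[OF ba_ideal_quotient[OF M(1) that(1)]] that a(1) by blast
  have prime: "meet B x y \<notin> M" if "x \<in> car B - M" "y \<in> car B - M" for x y
  proof
    assume "meet B x y \<in> M"
    \<comment> \<open>\<open>max'\<close> trades one factor outside \<open>M\<close> for
      \<open>a\<close>. Used first on \<open>y\<close> and then on \<open>x\<close>, it leads to
      \<open>meet B a a\<close>, which is \<open>a\<close>.\<close>
    then have "meet B a x \<in> M"
      using max'[of x y] that a(1) ba_commute[of a x] by auto
    then have "meet B a a \<in> M"
      using max'[of a x] that a(1) by auto
    then show False
      using ba_idem a(1) M(3) by simp
  qed
  have up: "join B x y \<notin> M" if "x \<in> car B - M" "y \<in> car B" for x y
    using meetM[of "join B x y" x] that ba_absorb[of x y] ba_commute(2)[of x "join B x y"] ba_closed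
    by auto
  have "x \<notin> M \<or> cmp B x \<notin> M" if "x \<in> car B" for x
    using joinM[of x "cmp B x"] unt that ba_neutral by auto
  then have "car B - M \<in> ultrafilters B"
    using prime up unt zer ba_closed by (auto simp: ultrafilters_def)
  then show ?thesis
    using that a(1) M by blast
qed

section \<open>Membership laws of ultrafilters\<close>

lemma ultrafilter_sub: "F \<in> ultrafilters B \<Longrightarrow> F \<subseteq> car B"
  by (simp add: ultrafilters_def)

lemma ultrafilter_unt: "F \<in> ultrafilters B \<Longrightarrow> unt B \<in> F"
  and ultrafilter_zer: "F \<in> ultrafilters B \<Longrightarrow> zer B \<notin> F"
  by (simp_all add: ultrafilters_def)

lemma ultrafilter_up:
  assumes "F \<in> ultrafilters B" "x \<in> F" "y \<in> car B"
  shows "join B x y \<in> F"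
  using assms by (simp add: ultrafilters_def)

text \<open>Upward closure of a filter is phrased with joins. Absorption writes \<open>x\<close> as
  the join of \<open>meet B x y\<close> with \<open>x\<close>, which brings it into that
  form.\<close>

lemma ultrafilter_meet:
  assumes F: "F \<in> ultrafilters B" and x: "x \<in> car B" "y \<in> car B"
  shows "meet B x y \<in> F \<longleftrightarrow> x \<in> F \<and> y \<in> F"
proof
  assume *: "meet B x y \<in> F"
  have "join B (meet B x y) x = x" "join B (meet B x y) y = y"
    using ba_absorb[of x y] ba_absorb[of y x] ba_commute[of "meet B x y"] ba_commute[of x y]
      x ba_closed by auto
  then show "x \<in> F \<and> y \<in> F"
    using ultrafilter_up[OF F *] x by metis
qed (use F in \<open>simp add: ultrafilters_def\<close>)

lemma ultrafilter_cmp: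
  assumes F: "F \<in> ultrafilters B" and x: "x \<in> car B"
  shows "cmp B x \<in> F \<longleftrightarrow> x \<notin> F"
proof -
  have "x \<in> F \<or> cmp B x \<in> F"
    using F x by (simp add: ultrafilters_def)
  moreover have "\<not> (x \<in> F \<and> cmp B x \<in> F)"
    using ultrafilter_meet[OF F x, of "cmp B x"] ultrafilter_zer[OF F] x ba_closed ba_neutral
    by auto
  ultimately show ?thesis
    by blast
qed

lemma ultrafilter_join:
  assumes F: "F \<in> ultrafilters B" and x: "x \<in> car B" "y \<in> car B"
  shows "join B x y \<in> F \<longleftrightarrow> x \<in> F \<or> y \<in> F"
proof
  assume *: "join B x y \<in> F"
  show "x \<in> F \<or> y \<in> F"
  proof (rule ccontr)
    assume "\<not> ?thesis"
    then have n: "x \<notin> F" "cmp B y \<in> F"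
      using ultrafilter_cmp[OF F] x by auto
    then have "meet B (cmp B y) (join B x y) \<in> F"
      using * ultrafilter_meet[OF F] x ba_closed by auto
    moreover have "meet B (cmp B y) (join B x y) = meet B (cmp B y) x"
      using ba_distrib(1)[of "cmp B y" x y] ba_commute[of "cmp B y" y] ba_neutral[of y]
        ba_neutral[of "meet B (cmp B y) x"] x ba_closed by auto
    ultimately show False
      using n ultrafilter_meet[OF F] x ba_closed by auto
  qed
next
  assume "x \<in> F \<or> y \<in> F"
  then show "join B x y \<in> F"
    using ultrafilter_up[OF F] x ba_commute(1)[of x y] by metis
qed

text \<open>An element of \<open>G\<close> outside \<open>F\<close> would have its complement in
  \<open>F\<close>, hence in \<open>G\<close> as well.\<close>

lemma ultrafilter_maximal:
  assumes F: "F \<in> ultrafilters B" and G: "G \<in> ultrafilters B" and "F \<subseteq> G"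
  shows "F = G"
  using assms ultrafilter_cmp[OF F] ultrafilter_cmp[OF G] ultrafilter_sub[OF G] by blast

end

section \<open>The topology of the spectrum\<close>

definition stone_set :: "'a ba \<Rightarrow> 'a \<Rightarrow> 'a set set" where
  "stone_set B a = {F \<in> ultrafilters B. a \<in> F}"

context
  fixes B :: "'a ba"
  assumes B: "boolean_alg B"
begin

lemma stone_set_ops:
  "stone_set B (zer B) = {}" "stone_set B (unt B) = ultrafilters B"
  "x \<in> car B \<Longrightarrow> stone_set B (cmp B x) = ultrafilters B - stone_set B x"
  "x \<in> car B \<Longrightarrow> y \<in> car B \<Longrightarrow> stone_set B (join B x y) = stone_set B x \<union> stone_set B y"
  "x \<in> car B \<Longrightarrow> y \<in> car B \<Longrightarrow> stone_set B (meet B x y) = stone_set B x \<inter> stone_set B y"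
  by (auto simp: stone_set_def ultrafilter_zer[OF B] ultrafilter_unt[OF B] ultrafilter_cmp[OF B]
      ultrafilter_join[OF B] ultrafilter_meet[OF B])

text \<open>If \<open>meet B a (cmp B b)\<close> were nonzero, an ultrafilter containing it would
  lie in the Stone set of \<open>a\<close> but not in that of \<open>b\<close>. So it is zero, which
  says that \<open>a\<close> is below \<open>b\<close>. The argument is then repeated with
  \<open>a\<close> and \<open>b\<close> exchanged.\<close>

lemma stone_set_inj:
  assumes a: "a \<in> car B" "b \<in> car B" and eq: "stone_set B a = stone_set B b"
  shows "a = b"
proof -
  have *: "meet B a b = a" if "a \<in> car B" "b \<in> car B" "stone_set B a = stone_set B b" for a b
  proof -
    let ?c = "meet B a (cmp B b)"
    have c: "?c \<in> car B"
      using that ba_closed[OF B] by simp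
    have "?c = zer B"
    proof (rule ccontr)
      assume "?c \<noteq> zer B"
      then have "?c \<notin> {zer B}"
        by simp
      then obtain F where "F \<in> ultrafilters B" "?c \<in> F"
        using ex_ultrafilter_avoiding[OF B ba_ideal_zero[OF B] c] by metis
      then have "F \<in> stone_set B ?c"
        by (simp add: stone_set_def)
      then show False
        using stone_set_ops that ba_closed[OF B] by auto
    qed
    then show ?thesis
      using ba_distrib(1)[OF B, of a b "cmp B b"] ba_neutral[OF B, of b] ba_neutral[OF B, of a]
        ba_neutral[OF B, of "meet B a b"] that ba_closed[OF B] by auto
  qed
  show ?thesis
    using *[OF a eq] *[OF a(2,1) eq[symmetric]] ba_commute[OF B a] by simp
qed

text \<open>Every compactness argument on the spectrum goes through this form of the prime ideal
  theorem.\<close>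

lemma unt_in_ideal:
  assumes "ba_ideal B K" "\<And>F. F \<in> ultrafilters B \<Longrightarrow> F \<inter> K \<noteq> {}"
  shows "unt B \<in> K"
  using ex_ultrafilter_avoiding[OF B assms(1) ba_closed(2)[OF B]] assms(2) by metis

text \<open>The Stone sets generate the topology as a subbase. They are already a base, because the
  intersection of two of them is the Stone set of a meet.\<close>

lemma openin_spec_iff:
  "openin (fst (spec (B, J))) W \<longleftrightarrow>
     W \<subseteq> ultrafilters B \<and> (\<forall>F\<in>W. \<exists>a\<in>car B. F \<in> stone_set B a \<and> stone_set B a \<subseteq> W)"
  (is "_ \<longleftrightarrow> ?P W")
proof
  let ?S = "stone_set B ` car B"
  have eq: "openin (fst (spec (B, J))) W \<longleftrightarrow> generate_topology_on ?S W" for W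
    by (simp add: spec_def stone_set_def[abs_def] openin_topology_generated_by_iff)
  show "?P W" if "openin (fst (spec (B, J))) W"
  proof -
    have "generate_topology_on ?S W"
      using that eq by simp
    then show ?thesis
    proof (induction rule: generate_topology_on.induct)
      case (Int V W)
      have "\<exists>c\<in>car B. F \<in> stone_set B c \<and> stone_set B c \<subseteq> V \<inter> W" if F: "F \<in> V \<inter> W" for F
      proof -
        obtain a b where ab: "a \<in> car B" "F \<in> stone_set B a" "stone_set B a \<subseteq> V"
          "b \<in> car B" "F \<in> stone_set B b" "stone_set B b \<subseteq> W"
          using Int.IH F by blast
        then show ?thesis
          using stone_set_ops(5)[of a b] ba_closed(5)[OF B, of a b] by (intro bexI[of _ "meet B a b"]) auto
      qed
      then show ?case
        using Int.IH by blast
    next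
      case (UN K)
      then show ?case
        by (meson Sup_least UnionE Union_upper subset_trans)
    qed (auto simp: stone_set_def)
  qed
  show "openin (fst (spec (B, J))) W" if "?P W"
  proof -
    have "W = \<Union>{V \<in> ?S. V \<subseteq> W}"
      using that by blast
    moreover have "generate_topology_on ?S (\<Union>{V \<in> ?S. V \<subseteq> W})"
      by (intro generate_topology_on.UN generate_topology_on.Basis) blast
    ultimately show ?thesis
      using eq by simp
  qed
qed

lemma topspace_spec: "topspace (fst (spec (B, J))) = ultrafilters B"
proof -
  have "topspace (fst (spec (B, J))) = (\<Union>a\<in>car B. stone_set B a)"
    by (simp add: spec_def stone_set_def)
  also have "\<dots> = ultrafilters B"
  proof
    show "(\<Union>a\<in>car B. stone_set B a) \<subseteq> ultrafilters B"
      by (auto simp: stone_set_def)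
    show "ultrafilters B \<subseteq> (\<Union>a\<in>car B. stone_set B a)"
      using ba_closed(2)[OF B] stone_set_ops(2) by blast
  qed
  finally show ?thesis .
qed

lemma openin_stone_set: "a \<in> car B \<Longrightarrow> openin (fst (spec (B, J))) (stone_set B a)"
  unfolding openin_spec_iff by (auto simp: stone_set_def)

text \<open>For a clopen \<open>V\<close>, the ideal \<open>?K\<close> collects the elements below
  which \<open>V\<close> is represented by an element of \<open>B\<close>. Openness of
  \<open>V\<close> gives every ultrafilter in \<open>V\<close> an element of \<open>?K\<close>, and
  openness of the complement does so for the others. Once the unit is in \<open>?K\<close>, the set
  \<open>V\<close> itself is a Stone set.\<close>

lemma clopens_spec: "clopens (fst (spec (B, J))) = stone_set B ` car B"
proof
  show "stone_set B ` car B \<subseteq> clopens (fst (spec (B, J)))"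
    using openin_stone_set stone_set_ops(3) ba_closed(3)[OF B]
    by (force simp: clopens_def closedin_def topspace_spec stone_set_def)
  show "clopens (fst (spec (B, J))) \<subseteq> stone_set B ` car B"
  proof
    fix V assume V: "V \<in> clopens (fst (spec (B, J)))"
    let ?K = "{a \<in> car B. \<exists>b\<in>car B. stone_set B b = stone_set B a \<inter> V}"
    have sub: "V \<subseteq> ultrafilters B"
      using V openin_subset by (fastforce simp: clopens_def topspace_spec)
    have "ba_ideal B ?K"
      unfolding ba_ideal_def
    proof (intro conjI ballI)
      show "zer B \<in> ?K"
        using ba_closed(1)[OF B] stone_set_ops(1) by auto
    next
      fix x y assume "x \<in> ?K" "y \<in> ?K"
      then obtain b c where "b \<in> car B" "stone_set B b = stone_set B x \<inter> V"
        "c \<in> car B" "stone_set B c = stone_set B y \<inter> V" "x \<in> car B" "y \<in> car B"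
        by blast
      then show "join B x y \<in> ?K"
        using stone_set_ops(4) ba_closed(4)[OF B] by (auto intro!: bexI[of _ "join B b c"])
    next
      fix x y assume "x \<in> ?K" "y \<in> car B"
      moreover then obtain b where "b \<in> car B" "stone_set B b = stone_set B x \<inter> V" "x \<in> car B"
        by blast
      ultimately show "meet B x y \<in> ?K"
        using stone_set_ops(5) ba_closed(5)[OF B] by (auto intro!: bexI[of _ "meet B b y"])
    qed blast
    moreover have "F \<inter> ?K \<noteq> {}" if F: "F \<in> ultrafilters B" for F
    proof (cases "F \<in> V")
      case True
      then obtain a where "a \<in> car B" "F \<in> stone_set B a" "stone_set B a \<subseteq> V"
        using V unfolding clopens_def openin_spec_iff by blast
      then show ?thesis
        by (auto simp: stone_set_def)
    next
      case False
      have "openin (fst (spec (B, J))) (ultrafilters B - V)"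
        using V by (simp add: clopens_def closedin_def topspace_spec)
      then obtain a where "a \<in> car B" "F \<in> stone_set B a" "stone_set B a \<subseteq> ultrafilters B - V"
        using False F unfolding openin_spec_iff by blast
      \<comment> \<open>The Stone set of \<open>a\<close> is disjoint from \<open>V\<close>, so the
        zero element represents the trace of \<open>V\<close> on it.\<close>
      then have "a \<in> F" "stone_set B (zer B) = stone_set B a \<inter> V"
        using stone_set_ops(1) by (auto simp: stone_set_def)
      then show ?thesis
        using \<open>a \<in> car B\<close> ba_closed(1)[OF B] by blast
    qed
    ultimately have "unt B \<in> ?K"
      by (rule unt_in_ideal)
    then show "V \<in> stone_set B ` car B"
      using stone_set_ops(2) sub by auto
  qed
qed

text \<open>The elements whose Stone sets have a finite subcover form an ideal. Every ultrafilter
  meets it, since some basic neighbourhood of the ultrafilter lies in a single member of the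
  cover.\<close>

lemma compact_space_spec: "compact_space (fst (spec (B, J)))"
  unfolding compact_space_alt
proof (intro allI impI, elim conjE)
  fix \<U> assume op: "\<forall>W\<in>\<U>. openin (fst (spec (B, J))) W"
    and cover: "topspace (fst (spec (B, J))) \<subseteq> \<Union>\<U>"
  let ?K = "{a \<in> car B. \<exists>\<F>. finite \<F> \<and> \<F> \<subseteq> \<U> \<and> stone_set B a \<subseteq> \<Union>\<F>}"
  have "ba_ideal B ?K"
    unfolding ba_ideal_def
  proof (intro conjI ballI)
    show "zer B \<in> ?K"
      using ba_closed(1)[OF B] stone_set_ops(1) by auto
  next
    fix x y assume "x \<in> ?K" "y \<in> ?K"
    then obtain \<F> \<G> where "finite \<F>" "\<F> \<subseteq> \<U>" "stone_set B x \<subseteq> \<Union>\<F>"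
      "finite \<G>" "\<G> \<subseteq> \<U>" "stone_set B y \<subseteq> \<Union>\<G>" "x \<in> car B" "y \<in> car B"
      by blast
    then show "join B x y \<in> ?K"
      using stone_set_ops(4) ba_closed(4)[OF B] by (auto intro!: exI[of _ "\<F> \<union> \<G>"])
  next
    fix x y assume "x \<in> ?K" "y \<in> car B"
    then show "meet B x y \<in> ?K"
      using stone_set_ops(5) ba_closed(5)[OF B] by auto
  qed blast
  moreover have "F \<inter> ?K \<noteq> {}" if F: "F \<in> ultrafilters B" for F
  proof -
    obtain W where W: "W \<in> \<U>" "F \<in> W"
      using cover F by (auto simp: topspace_spec)
    then obtain a where "a \<in> car B" "F \<in> stone_set B a" "stone_set B a \<subseteq> W"
      using op unfolding openin_spec_iff by blast
    then have "a \<in> F \<inter> ?K"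
      using W by (auto simp: stone_set_def[of _ a] intro!: exI[of _ "{W}"])
    then show ?thesis
      by blast
  qed
  ultimately have "unt B \<in> ?K"
    by (rule unt_in_ideal)
  then show "\<exists>\<F>. finite \<F> \<and> \<F> \<subseteq> \<U> \<and> topspace (fst (spec (B, J))) \<subseteq> \<Union>\<F>"
    by (auto simp: stone_set_ops(2) topspace_spec)
qed

lemma stone_space_spec: "stone_space (fst (spec (B, J)))"
  unfolding stone_space_def
proof (intro conjI compact_space_spec)
  have "\<exists>U V. openin (fst (spec (B, J))) U \<and> openin (fst (spec (B, J))) V \<and> F \<in> U \<and> G \<in> V \<and> disjnt U V"
    if F: "F \<in> ultrafilters B" and G: "G \<in> ultrafilters B" and "F \<noteq> G" for F G
  proof -
    \<comment> \<open>By maximality distinct ultrafilters are incomparable. The Stone sets of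
      \<open>a\<close> and of its complement separate them.\<close>
    obtain a where a: "a \<in> F" "a \<notin> G"
      using ultrafilter_maximal[OF B F G] \<open>F \<noteq> G\<close> by blast
    then have c: "a \<in> car B"
      using ultrafilter_sub[OF B F] by blast
    show ?thesis
      using openin_stone_set[OF c] openin_stone_set[OF ba_closed(3)[OF B c]] stone_set_ops(3)[OF c] a F G
      by (intro exI[of _ "stone_set B a"] exI[of _ "stone_set B (cmp B a)"])
        (auto simp: stone_set_def disjnt_def)
  qed
  then show "Hausdorff_space (fst (spec (B, J)))"
    by (simp add: Hausdorff_space_def topspace_spec)
  show "neighbourhood_base_of (\<lambda>V. V \<in> clopens (fst (spec (B, J)))) (fst (spec (B, J)))"
    unfolding neighbourhood_base_of
  proof (intro allI impI, elim conjE)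
    fix W F assume "openin (fst (spec (B, J))) W" "F \<in> W"
    then obtain a where "a \<in> car B" "F \<in> stone_set B a" "stone_set B a \<subseteq> W"
      unfolding openin_spec_iff by blast
    then show "\<exists>U V. openin (fst (spec (B, J))) U \<and> V \<in> clopens (fst (spec (B, J))) \<and> F \<in> U \<and> U \<subseteq> V \<and> V \<subseteq> W"
      using openin_stone_set clopens_spec
      by (intro exI[of _ "stone_set B a"] conjI) auto
  qed
qed

end

section \<open>The two functors\<close>

lemma spec_simps:
  "spec (B, J) = (fst (spec (B, J)), \<lambda>i. {F \<in> ultrafilters B. F \<inter> J i \<noteq> {}})"
  by (simp add: spec_def)

lemma clop_simps:
  "car (fst (clop (X, u))) = clopens X" "join (fst (clop (X, u))) = (\<union>)"
  "meet (fst (clop (X, u))) = (\<inter>)" "cmp (fst (clop (X, u))) = (\<lambda>V. topspace X - V)"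
  "zer (fst (clop (X, u))) = {}" "unt (fst (clop (X, u))) = topspace X"
  "snd (clop (X, u)) i = {V \<in> clopens X. V \<subseteq> u i}"
  by (simp_all add: clop_def)

lemma clopens_closed:
  "{} \<in> clopens X" "topspace X \<in> clopens X"
  "V \<in> clopens X \<Longrightarrow> topspace X - V \<in> clopens X"
  "V \<in> clopens X \<Longrightarrow> W \<in> clopens X \<Longrightarrow> V \<union> W \<in> clopens X"
  "V \<in> clopens X \<Longrightarrow> W \<in> clopens X \<Longrightarrow> V \<inter> W \<in> clopens X"
  "V \<in> clopens X \<Longrightarrow> V \<subseteq> topspace X"
  by (auto simp: clopens_def openin_subset closedin_subset
      intro: openin_diff closedin_diff openin_Un closedin_Un openin_Int closedin_Int dest: openin_subset)

lemma boole_obD: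
  assumes "boole_ob n (B, J)"
  shows "boolean_alg B" "i \<in> {1..<n} \<Longrightarrow> ba_ideal B (J i)" "i \<in> {1..<n} \<Longrightarrow> J i = J (n - i)"
    "i \<in> {2..<n} \<Longrightarrow> h \<in> {1..<i} \<Longrightarrow> J h \<inter> J (i - h) \<subseteq> J i"
  using assms unfolding boole_ob_def by blast+

lemmas boole_ob_alg = boole_obD(1)

lemma ideal_subset: "boole_ob n (B, J) \<Longrightarrow> i \<in> {1..<n} \<Longrightarrow> J i \<subseteq> car B"
  using boole_obD(2) unfolding ba_ideal_def by blast

lemma top_obD:
  assumes "top_ob n (X, u)"
  shows "i \<in> {1..<n} \<Longrightarrow> openin X (u i)" "i \<in> {1..<n} \<Longrightarrow> u i = u (n - i)"
    "i \<in> {2..<n} \<Longrightarrow> h \<in> {1..<i} \<Longrightarrow> u h \<inter> u (i - h) \<subseteq> u i"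
  using assms unfolding top_ob_def by blast+

lemma ba_hom_simps:
  assumes "f \<in> ba_hom A B"
  shows "x \<in> car A \<Longrightarrow> f x \<in> car B" "f (zer A) = zer B" "f (unt A) = unt B"
    "x \<in> car A \<Longrightarrow> f (cmp A x) = cmp B (f x)"
    "x \<in> car A \<Longrightarrow> y \<in> car A \<Longrightarrow> f (join A x y) = join B (f x) (f y)"
    "x \<in> car A \<Longrightarrow> y \<in> car A \<Longrightarrow> f (meet A x y) = meet B (f x) (f y)"
  using assms by (auto simp: ba_hom_def)

text \<open>For condition (ii), take \<open>a\<close> in \<open>F\<close> and \<open>J h\<close>,
  and \<open>b\<close> in \<open>F\<close> and \<open>J (i - h)\<close>. Their meet lies in both
  ideals, hence in \<open>J i\<close>, and it also lies in \<open>F\<close>.\<close>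

lemma stone_ob_spec:
  assumes ob: "boole_ob n (B, J)"
  shows "stone_ob n (spec (B, J))"
proof -
  note B = boole_ob_alg[OF ob]
  let ?o = "\<lambda>i. {F \<in> ultrafilters B. F \<inter> J i \<noteq> {}}"
  have id: "ba_ideal B (J i)" if "i \<in> {1..<n}" for i
    using boole_obD(2)[OF ob that] .
  have op: "openin (fst (spec (B, J))) (?o i)" if i: "i \<in> {1..<n}" for i
    unfolding openin_spec_iff[OF B]
  proof (intro conjI ballI)
    fix F assume "F \<in> ?o i"
    then obtain a where a: "a \<in> F" "a \<in> J i" "F \<in> ultrafilters B"
      by blast
    then have "a \<in> car B"
      using ideal_subset[OF ob i] by blast
    then show "\<exists>a\<in>car B. F \<in> stone_set B a \<and> stone_set B a \<subseteq> ?o i"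
      using a by (intro bexI[of _ a]) (auto simp: stone_set_def)
  qed blast
  have "?o h \<inter> ?o (i - h) \<subseteq> ?o i" if i: "i \<in> {2..<n}" and h: "h \<in> {1..<i}" for i h
  proof
    fix F assume "F \<in> ?o h \<inter> ?o (i - h)"
    then obtain a b where F: "F \<in> ultrafilters B" and ab: "a \<in> F" "a \<in> J h" "b \<in> F" "b \<in> J (i - h)"
      by blast
    have hi: "h \<in> {1..<n}" "i - h \<in> {1..<n}"
      using i h by auto
    have car: "a \<in> car B" "b \<in> car B"
      using ab ultrafilter_sub[OF B F] by auto
    have "meet B a b \<in> J h" "meet B b a \<in> J (i - h)"
      using id[OF hi(1)] id[OF hi(2)] ab car by (auto simp: ba_ideal_def)
    then have "meet B a b \<in> J h \<inter> J (i - h)"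
      using ba_commute(2)[OF B car] by simp
    also have "\<dots> \<subseteq> J i"
      using boole_obD(4)[OF ob i h] .
    finally show "F \<in> ?o i"
      using F ab ultrafilter_meet[OF B F car] by blast
  qed
  moreover have "?o i = ?o (n - i)" if "i \<in> {1..<n}" for i
    using boole_obD(3)[OF ob that] by metis
  ultimately have "top_ob n (fst (spec (B, J)), ?o)"
    unfolding top_ob_def prod.case using op by (intro conjI ballI)
  then show ?thesis
    using stone_space_spec[OF B] by (simp add: stone_ob_def spec_simps[symmetric])
qed

lemma ultrafilter_preimage:
  assumes A: "boolean_alg A" and B: "boolean_alg B" and f: "f \<in> ba_hom A B" and G: "G \<in> ultrafilters B"
  shows "{a \<in> car A. f a \<in> G} \<in> ultrafilters A"
proof -
  note h = ba_hom_simps[OF f]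
  show ?thesis
    unfolding ultrafilters_def
    using G h ba_closed[OF A] ultrafilter_meet[OF B G] ultrafilter_join[OF B G]
      ultrafilter_cmp[OF B G] ultrafilter_unt[OF B G] ultrafilter_zer[OF B G] by auto
qed

text \<open>The preimage of the Stone set of \<open>a\<close> is the Stone set of
  \<open>f a\<close>, which gives continuity. If the preimage of \<open>G\<close> contains some
  \<open>a\<close> in \<open>I i\<close>, then \<open>G\<close> contains \<open>f a\<close>, an
  element of \<open>J i\<close>; this is the required inclusion of open sets.\<close>

lemma spec_map_hom:
  assumes ob: "boole_ob n (A, I)" "boole_ob n (B, J)" and f: "f \<in> boole_hom n (A, I) (B, J)"
  shows "spec_map (A, I) (B, J) f \<in> top_hom n (spec (B, J)) (spec (A, I))"
proof -
  note A = boole_ob_alg[OF ob(1)] and B = boole_ob_alg[OF ob(2)]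
  let ?g = "spec_map (A, I) (B, J) f"
  have f': "f \<in> ba_hom A B" and fI: "\<And>i. i \<in> {1..<n} \<Longrightarrow> f ` I i \<subseteq> J i"
    using f by (auto simp: boole_hom_def)
  have g: "?g G = {a \<in> car A. f a \<in> G}" if "G \<in> ultrafilters B" for G
    using that by (simp add: spec_map_def)
  have gu: "?g G \<in> ultrafilters A" if "G \<in> ultrafilters B" for G
    using ultrafilter_preimage[OF A B f' that] g[OF that] by simp
  have "openin (fst (spec (B, J))) {G \<in> ultrafilters B. ?g G \<in> W}"
    if W: "openin (fst (spec (A, I))) W" for W
    unfolding openin_spec_iff[OF B]
  proof (intro conjI ballI)
    fix G assume "G \<in> {G \<in> ultrafilters B. ?g G \<in> W}"
    then have G: "G \<in> ultrafilters B" "?g G \<in> W"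
      by auto
    then obtain a where a: "a \<in> car A" "?g G \<in> stone_set A a" "stone_set A a \<subseteq> W"
      using W unfolding openin_spec_iff[OF A] by blast
    have "stone_set B (f a) \<subseteq> {G \<in> ultrafilters B. ?g G \<in> W}"
    proof
      fix H assume "H \<in> stone_set B (f a)"
      then have H: "H \<in> ultrafilters B" "f a \<in> H"
        by (auto simp: stone_set_def)
      then have "?g H \<in> stone_set A a"
        using gu g a(1) by (simp add: stone_set_def)
      then show "H \<in> {G \<in> ultrafilters B. ?g G \<in> W}"
        using H a(3) by blast
    qed
    moreover have "G \<in> stone_set B (f a)"
      using a G(1) g by (simp add: stone_set_def)
    ultimately show "\<exists>b\<in>car B. G \<in> stone_set B b \<and> stone_set B b \<subseteq> {G \<in> ultrafilters B. ?g G \<in> W}"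
      using ba_hom_simps(1)[OF f' a(1)] by blast
  qed blast
  then have cont: "continuous_map (fst (spec (B, J))) (fst (spec (A, I))) ?g"
    using gu by (simp add: continuous_map_def topspace_spec[OF A] topspace_spec[OF B])
  have "{G \<in> ultrafilters B. ?g G \<in> {F \<in> ultrafilters A. F \<inter> I i \<noteq> {}}}
      \<subseteq> {F \<in> ultrafilters B. F \<inter> J i \<noteq> {}}" if "i \<in> {1..<n}" for i
    using fI[OF that] g by blast
  then have "?g \<in> top_hom n (fst (spec (B, J)), \<lambda>i. {F \<in> ultrafilters B. F \<inter> J i \<noteq> {}})
    (fst (spec (A, I)), \<lambda>i. {F \<in> ultrafilters A. F \<inter> I i \<noteq> {}})"
    using cont gu unfolding top_hom_def topspace_spec[OF A] topspace_spec[OF B] prod.case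
    by (auto simp: topspace_spec[OF A] topspace_spec[OF B] spec_map_def restrict_def)
  then show ?thesis
    by (simp add: spec_simps[symmetric])
qed

lemma spec_map_id:
  assumes "boole_ob n (A, I)"
  shows "spec_map (A, I) (A, I) (boole_id (A, I)) = top_id (spec (A, I))"
proof
  note A = boole_ob_alg[OF assms]
  fix F
  show "spec_map (A, I) (A, I) (boole_id (A, I)) F = top_id (spec (A, I)) F"
    using ultrafilter_sub[OF A]
    by (auto simp: spec_map_def boole_id_def top_id_def topspace_spec[OF A] restrict_def)
qed

lemma spec_map_comp:
  assumes ob: "boole_ob n (A, I)" "boole_ob n (B, J)" "boole_ob n (C, K)"
    and f: "f \<in> boole_hom n (A, I) (B, J)" and g: "g \<in> boole_hom n (B, J) (C, K)"
  shows "spec_map (A, I) (C, K) (boole_comp (A, I) g f) =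
    top_comp (spec (C, K)) (spec_map (A, I) (B, J) f) (spec_map (B, J) (C, K) g)"
proof
  note A = boole_ob_alg[OF ob(1)] and B = boole_ob_alg[OF ob(2)] and C = boole_ob_alg[OF ob(3)]
  have f': "f \<in> ba_hom A B" and g': "g \<in> ba_hom B C"
    using f g by (auto simp: boole_hom_def)
  fix F
  show "spec_map (A, I) (C, K) (boole_comp (A, I) g f) F =
    top_comp (spec (C, K)) (spec_map (A, I) (B, J) f) (spec_map (B, J) (C, K) g) F"
    using ultrafilter_preimage[OF B C g', of F] ba_hom_simps(1)[OF f']
    by (auto simp: spec_map_def boole_comp_def top_comp_def topspace_spec[OF C] compose_def)
qed

section \<open>The clopen algebra functor\<close>

lemma boole_ob_clop:
  assumes "top_ob n (X, u)"
  shows "boole_ob n (clop (X, u))"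
proof -
  have "boolean_alg (fst (clop (X, u)))"
    unfolding boolean_alg_def clop_simps
    by (intro conjI ballI) (auto simp: clopens_closed(1-5) dest: clopens_closed(6))
  moreover have "ba_ideal (fst (clop (X, u))) (snd (clop (X, u)) i)" for i
    unfolding ba_ideal_def clop_simps using clopens_closed[where X = X] by blast
  moreover have "snd (clop (X, u)) i = snd (clop (X, u)) (n - i)" if "i \<in> {1..<n}" for i
    unfolding clop_simps using top_obD(2)[OF assms that] by metis
  moreover have "snd (clop (X, u)) h \<inter> snd (clop (X, u)) (i - h) \<subseteq> snd (clop (X, u)) i"
    if "i \<in> {2..<n}" "h \<in> {1..<i}" for i h
    unfolding clop_simps using top_obD(3)[OF assms that] by blast
  ultimately show ?thesis
    unfolding boole_ob_def case_prod_beta by (intro conjI ballI)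
qed

lemma clop_map_hom:
  assumes f: "f \<in> top_hom n (X, u) (Y, v)"
  shows "clop_map (X, u) (Y, v) f \<in> boole_hom n (clop (Y, v)) (clop (X, u))"
proof -
  let ?p = "\<lambda>V. {x \<in> topspace X. f x \<in> V}"
  have c: "continuous_map X Y f" and fu: "\<And>i. i \<in> {1..<n} \<Longrightarrow> ?p (v i) \<subseteq> u i"
    using f by (auto simp: top_hom_def)
  have f1: "f x \<in> topspace Y" if "x \<in> topspace X" for x
    using c that by (auto simp: continuous_map_def)
  have p: "?p V \<in> clopens X" if "V \<in> clopens Y" for V
    using c that openin_continuous_map_preimage closedin_continuous_map_preimage
    by (fastforce simp: clopens_def)
  have m: "clop_map (X, u) (Y, v) f V = ?p V" if "V \<in> clopens Y" for V
    using that by (simp add: clop_map_def)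
  have "clop_map (X, u) (Y, v) f \<in> ba_hom (fst (clop (Y, v))) (fst (clop (X, u)))"
    unfolding ba_hom_def clop_simps
    using p m f1 clopens_closed[where X = Y] by (auto simp: clop_map_def)
  moreover have "clop_map (X, u) (Y, v) f ` snd (clop (Y, v)) i \<subseteq> snd (clop (X, u)) i"
    if "i \<in> {1..<n}" for i
    using fu[OF that] p m unfolding clop_simps by auto
  ultimately show ?thesis
    by (simp add: boole_hom_def case_prod_beta)
qed

lemma clop_map_id: "clop_map (X, u) (X, u) (top_id (X, u)) = boole_id (clop (X, u))"
proof
  fix V
  show "clop_map (X, u) (X, u) (top_id (X, u)) V = boole_id (clop (X, u)) V"
    using clopens_closed(6)[of V X]
    by (auto simp: clop_map_def top_id_def boole_id_def clop_simps restrict_def)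
qed

lemma clop_map_comp:
  assumes f: "f \<in> top_hom n (X, u) (Y, v)" and g: "g \<in> top_hom n (Y, v) (Z, w)"
  shows "clop_map (X, u) (Z, w) (top_comp (X, u) g f) =
    boole_comp (clop (Z, w)) (clop_map (X, u) (Y, v) f) (clop_map (Y, v) (Z, w) g)"
proof
  fix V
  have "f x \<in> topspace Y" if "x \<in> topspace X" for x
    using f that by (auto simp: top_hom_def)
  moreover have "{x \<in> topspace Y. g x \<in> V} \<in> clopens Y" if "V \<in> clopens Z"
    using g that openin_continuous_map_preimage closedin_continuous_map_preimage
    by (fastforce simp: clopens_def top_hom_def)
  ultimately show "clop_map (X, u) (Z, w) (top_comp (X, u) g f) V =
    boole_comp (clop (Z, w)) (clop_map (X, u) (Y, v) f) (clop_map (Y, v) (Z, w) g) V"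
    by (auto simp: clop_map_def top_comp_def boole_comp_def clop_simps compose_def)
qed

text \<open>The inverse of a bijective homomorphism is a homomorphism. Morphisms, however, only map
  \<open>I i\<close> into \<open>J i\<close>, so the ideals are compared by an equivalence; its
  forward direction makes the inverse a morphism.\<close>

lemma boole_isoI:
  assumes ob: "boole_ob n (A, I)" "boole_ob n (B, J)"
    and f: "f \<in> ba_hom A B" and bij: "bij_betw f (car A) (car B)"
    and ideals: "\<And>i x. i \<in> {1..<n} \<Longrightarrow> x \<in> car A \<Longrightarrow> f x \<in> J i \<longleftrightarrow> x \<in> I i"
  shows "boole_iso n (A, I) (B, J) f"
proof -
  note A = boole_ob_alg[OF ob(1)] and h = ba_hom_simps[OF f]
  \<comment> \<open>Morphisms are extensional functions, so the inverse must be
    \<open>undefined\<close> outside \<open>car B\<close>.\<close>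
  define g where "g = restrict (inv_into (car A) f) (car B)"
  have fg: "f (g y) = y" "g y \<in> car A" if "y \<in> car B" for y
    using bij that by (auto simp: g_def bij_betw_inv_into_right bij_betwE[OF bij_betw_inv_into[OF bij]])
  have gf: "g (f x) = x" if "x \<in> car A" for x
    using bij that h(1) by (simp add: g_def bij_betw_inv_into_left)
  have "f \<in> boole_hom n (A, I) (B, J)"
    using f ideals ideal_subset[OF ob(1)] by (fastforce simp: boole_hom_def)
  moreover have "g \<in> ba_hom B A"
    unfolding ba_hom_def
  proof (intro CollectI conjI ballI)
    show "g \<in> car B \<rightarrow>\<^sub>E car A"
      using fg by (auto simp: g_def)
    show "g (zer B) = zer A" "g (unt B) = unt A"
      using gf h(2,3) ba_closed(1,2)[OF A] by metis+
    show "g (cmp B x) = cmp A (g x)" if "x \<in> car B" for x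
      using gf h(4) ba_closed(3)[OF A] fg[OF that] by metis
    fix x y assume x: "x \<in> car B" and y: "y \<in> car B"
    show "g (join B x y) = join A (g x) (g y)"
      using gf h(5) ba_closed(4)[OF A] fg[OF x] fg[OF y] by metis
    show "g (meet B x y) = meet A (g x) (g y)"
      using gf h(6) ba_closed(5)[OF A] fg[OF x] fg[OF y] by metis
  qed
  moreover have "g ` J i \<subseteq> I i" if i: "i \<in> {1..<n}" for i
    using ideals[OF i] fg ideal_subset[OF ob(2) i] by fastforce
  ultimately have "f \<in> boole_hom n (A, I) (B, J)" "g \<in> boole_hom n (B, J) (A, I)"
    by (auto simp: boole_hom_def)
  moreover have "boole_comp (A, I) g f = boole_id (A, I)" "boole_comp (B, J) f g = boole_id (B, J)"
    using fg gf h(1) by (auto simp: boole_comp_def boole_id_def compose_def restrict_def)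
  ultimately show ?thesis
    unfolding boole_iso_def by blast
qed

text \<open>A continuous bijection need not be open, and a morphism bounds the preimage of
  \<open>v i\<close> on one side only. Both conditions are therefore equivalences, so that each also
  covers the inverse.\<close>

lemma top_isoI:
  assumes ob: "top_ob n (X, u)" "top_ob n (Y, v)"
    and f: "f \<in> extensional (topspace X)" and bij: "bij_betw f (topspace X) (topspace Y)"
    and op: "\<And>W. W \<subseteq> topspace Y \<Longrightarrow> openin Y W \<longleftrightarrow> openin X {x \<in> topspace X. f x \<in> W}"
    and o: "\<And>i x. i \<in> {1..<n} \<Longrightarrow> x \<in> topspace X \<Longrightarrow> f x \<in> v i \<longleftrightarrow> x \<in> u i"
  shows "top_iso n (X, u) (Y, v) f"
proof -
  define g where "g = restrict (inv_into (topspace X) f) (topspace Y)"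
  have f1: "f x \<in> topspace Y" if "x \<in> topspace X" for x
    using bij that by (simp add: bij_betwE)
  have fg: "f (g y) = y" "g y \<in> topspace X" if "y \<in> topspace Y" for y
    using bij that by (auto simp: g_def bij_betw_inv_into_right bij_betwE[OF bij_betw_inv_into[OF bij]])
  have gf: "g (f x) = x" if "x \<in> topspace X" for x
    using bij that f1 by (simp add: g_def bij_betw_inv_into_left)
  have "continuous_map X Y f"
    using op f1 openin_subset[of Y] by (auto simp: continuous_map_def)
  then have "f \<in> top_hom n (X, u) (Y, v)"
    using o f f1 by (auto simp: top_hom_def PiE_def)
  moreover have "openin Y {y \<in> topspace Y. g y \<in> W}" if "openin X W" for W
  proof -
    have "{x \<in> topspace X. f x \<in> {y \<in> topspace Y. g y \<in> W}} = W"
      using gf f1 openin_subset[OF that] by auto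
    then show ?thesis
      using op[of "{y \<in> topspace Y. g y \<in> W}"] that by simp
  qed
  then have "continuous_map Y X g"
    using fg by (auto simp: continuous_map_def)
  moreover have "{y \<in> topspace Y. g y \<in> u i} \<subseteq> v i" if "i \<in> {1..<n}" for i
    using o[OF that] fg by fastforce
  ultimately have "f \<in> top_hom n (X, u) (Y, v)" "g \<in> top_hom n (Y, v) (X, u)"
    using fg by (auto simp: top_hom_def g_def)
  moreover have "top_comp (X, u) g f = top_id (X, u)" "top_comp (Y, v) f g = top_id (Y, v)"
    using fg gf f1 by (auto simp: top_comp_def top_id_def compose_def restrict_def)
  ultimately show ?thesis
    unfolding top_iso_def by blast
qed

section \<open>The units\<close>

lemma boole_iso_unit:
  assumes ob: "boole_ob n (B, J)"
  shows "boole_iso n (B, J) (clop (spec (B, J))) (boole_unit (B, J))"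
proof -
  note B = boole_ob_alg[OF ob]
  obtain X u where X: "spec (B, J) = (X, u)"
    by force
  have u: "u = (\<lambda>i. {F \<in> ultrafilters B. F \<inter> J i \<noteq> {}})"
    using X by (simp add: spec_def)
  have top: "topspace X = ultrafilters B" and clopens: "clopens X = stone_set B ` car B"
    using topspace_spec[OF B, of J] clopens_spec[OF B, of J] X by auto
  have e: "boole_unit (B, J) a = stone_set B a" if "a \<in> car B" for a
    using that by (simp add: boole_unit_def stone_set_def)
  have bij: "bij_betw (boole_unit (B, J)) (car B) (clopens X)"
    using stone_set_inj[OF B] e by (auto simp: bij_betw_def inj_on_def clopens)
  have hom: "boole_unit (B, J) \<in> ba_hom B (fst (clop (X, u)))"
    unfolding ba_hom_def clop_simps top
    using e stone_set_ops[OF B] ba_closed[OF B] by (auto simp: boole_unit_def clopens stone_set_def[symmetric])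
  have ideals: "boole_unit (B, J) x \<in> snd (clop (X, u)) i \<longleftrightarrow> x \<in> J i"
    if i: "i \<in> {1..<n}" and x: "x \<in> car B" for i x
  proof
    assume "boole_unit (B, J) x \<in> snd (clop (X, u)) i"
    then have sub: "stone_set B x \<subseteq> {F \<in> ultrafilters B. F \<inter> J i \<noteq> {}}"
      using e[OF x] by (simp add: clop_simps u)
    show "x \<in> J i"
    proof (rule ccontr)
      \<comment> \<open>This uses the full strength of the prime ideal theorem: an ultrafilter
        through \<open>x\<close> that avoids \<open>J i\<close> is a point of the Stone set outside
        the open set.\<close>
      assume nx: "x \<notin> J i"
      have "ba_ideal B (J i)"
        using boole_obD(2)[OF ob i] .
      then obtain F where "F \<in> ultrafilters B" "x \<in> F" "F \<inter> J i = {}"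
        using ex_ultrafilter_avoiding[OF B _ x nx] by metis
      then show False
        using sub by (auto simp: stone_set_def)
    qed
  next
    assume "x \<in> J i"
    then show "boole_unit (B, J) x \<in> snd (clop (X, u)) i"
      using e x by (auto simp: clop_simps u clopens) (auto simp: stone_set_def)
  qed
  have "top_ob n (X, u)"
    using stone_ob_spec[OF ob] X by (simp add: stone_ob_def)
  then have "boole_ob n (fst (clop (X, u)), snd (clop (X, u)))"
    by (simp add: boole_ob_clop)
  then have "boole_iso n (B, J) (fst (clop (X, u)), snd (clop (X, u))) (boole_unit (B, J))"
    by (rule boole_isoI[OF ob _ hom]) (use bij ideals in \<open>simp_all only: clop_simps\<close>)
  then show ?thesis
    by (simp add: X)
qed

text \<open>At \<open>a\<close> in \<open>car A\<close>, both sides are the set of ultrafilters of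
  \<open>B\<close> that contain \<open>f a\<close>.\<close>

lemma boole_unit_natural:
  assumes ob: "boole_ob n (A, I)" "boole_ob n (B, J)" and f: "f \<in> boole_hom n (A, I) (B, J)"
  shows "boole_comp (A, I) (boole_unit (B, J)) f =
    boole_comp (A, I) (clop_map (spec (B, J)) (spec (A, I)) (spec_map (A, I) (B, J) f)) (boole_unit (A, I))"
proof
  note A = boole_ob_alg[OF ob(1)] and B = boole_ob_alg[OF ob(2)]
  have f': "f \<in> ba_hom A B"
    using f by (auto simp: boole_hom_def)
  fix a
  show "boole_comp (A, I) (boole_unit (B, J)) f a = boole_comp (A, I)
    (clop_map (spec (B, J)) (spec (A, I)) (spec_map (A, I) (B, J) f)) (boole_unit (A, I)) a"
  proof (cases "a \<in> car A")
    case True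
    then have "stone_set A a \<in> clopens (fst (spec (A, I)))"
      by (simp add: clopens_spec[OF A])
    then show ?thesis
      using True ba_hom_simps(1)[OF f'] ultrafilter_preimage[OF A B f']
      by (auto simp: boole_comp_def compose_def boole_unit_def clop_map_def stone_set_def
          topspace_spec[OF B] spec_map_def)
  qed (simp add: boole_comp_def compose_def)
qed

section \<open>Points of a Stone space as ultrafilters of clopen sets\<close>

lemma clopen_separation:
  assumes X: "stone_space X" and x: "x \<in> topspace X" "y \<in> topspace X"
    and sep: "\<And>V. V \<in> clopens X \<Longrightarrow> x \<in> V \<longleftrightarrow> y \<in> V"
  shows "x = y"
proof (rule ccontr)
  assume "x \<noteq> y"
  then obtain U W where "openin X U" "openin X W" "x \<in> U" "y \<in> W" "disjnt U W"
    using X x unfolding stone_space_def Hausdorff_space_def by blast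
  \<comment> \<open>Zero-dimensionality shrinks the neighbourhood \<open>U\<close> of
    \<open>x\<close> to a clopen set, which still misses \<open>y\<close>.\<close>
  moreover then obtain V where "V \<in> clopens X" "x \<in> V" "V \<subseteq> U"
    using X unfolding stone_space_def neighbourhood_base_of by blast
  ultimately show False
    using sep by (auto simp: disjnt_def)
qed

lemma clopen_base:
  assumes "stone_space X" "openin X W" "x \<in> W"
  obtains V where "V \<in> clopens X" "x \<in> V" "V \<subseteq> W"
  using assms unfolding stone_space_def neighbourhood_base_of by blast

lemma openin_stone_space_iff:
  assumes X: "stone_space X"
  shows "openin X W \<longleftrightarrow> (\<forall>x\<in>W. \<exists>V\<in>clopens X. x \<in> V \<and> V \<subseteq> W)"
proof
  assume "openin X W"
  then show "\<forall>x\<in>W. \<exists>V\<in>clopens X. x \<in> V \<and> V \<subseteq> W"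
    using clopen_base[OF X] by metis
next
  assume "\<forall>x\<in>W. \<exists>V\<in>clopens X. x \<in> V \<and> V \<subseteq> W"
  then show "openin X W"
    unfolding openin_subopen[of X W] clopens_def by blast
qed

lemma point_ultrafilter:
  assumes "x \<in> topspace X"
  shows "{V \<in> clopens X. x \<in> V} \<in> ultrafilters (fst (clop (X, u)))"
  unfolding ultrafilters_def clop_simps using assms clopens_closed[where X = X] by blast

text \<open>Compactness of \<open>X\<close> enters here. The members of \<open>F\<close> are closed
  sets with the finite intersection property, so they share a point \<open>x\<close>. Then
  \<open>F\<close> is contained in the ultrafilter of \<open>x\<close>, and maximality gives
  equality.\<close>

lemma ultrafilter_is_point:
  assumes X: "stone_space X" and ob: "top_ob n (X, u)" and F: "F \<in> ultrafilters (fst (clop (X, u)))"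
  obtains x where "x \<in> topspace X" "F = {V \<in> clopens X. x \<in> V}"
proof -
  have F': "F \<subseteq> clopens X" "topspace X \<in> F" "{} \<notin> F" "\<And>V W. V \<in> F \<Longrightarrow> W \<in> F \<Longrightarrow> V \<inter> W \<in> F"
    using F unfolding ultrafilters_def clop_simps by auto
  \<comment> \<open>A lower bound inside \<open>F\<close> is carried through the induction, since it
    is nonempty. It starts at \<open>topspace X\<close>, because the empty intersection is
    \<open>UNIV\<close>.\<close>
  have "\<exists>W\<in>F. W \<subseteq> \<Inter>\<F>" if "finite \<F>" "\<F> \<subseteq> F" for \<F>
    using that
  proof (induction rule: finite_induct)
    case empty
    then show ?case
      using F'(2) by blast
  next
    case (insert V \<F>)
    then obtain W where "W \<in> F" "W \<subseteq> \<Inter>\<F>" "V \<in> F"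
      by blast
    then show ?case
      using F'(4)[of V W] by blast
  qed
  then have "\<forall>\<F>. finite \<F> \<and> \<F> \<subseteq> F \<longrightarrow> \<Inter>\<F> \<noteq> {}"
    using F'(3) by fastforce
  moreover have "\<forall>C\<in>F. closedin X C"
    using F'(1) by (auto simp: clopens_def)
  ultimately have "\<Inter>F \<noteq> {}"
    using X unfolding stone_space_def compact_space_fip by blast
  then obtain x where x: "\<And>V. V \<in> F \<Longrightarrow> x \<in> V"
    by blast
  then have xX: "x \<in> topspace X"
    using F'(2) by blast
  have "F \<subseteq> {V \<in> clopens X. x \<in> V}"
    using x F'(1) by blast
  moreover have "boolean_alg (fst (clop (X, u)))"
    using boole_ob_clop[OF ob] boole_obD(1) by (metis prod.collapse)
  ultimately have "F = {V \<in> clopens X. x \<in> V}"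
    using ultrafilter_maximal F point_ultrafilter[OF xX] by metis
  then show ?thesis
    using that xX by blast
qed

text \<open>Under the unit, the Stone set of a clopen \<open>V\<close> corresponds to
  \<open>V\<close> itself (\<open>in_stone\<close>). The bases of both spaces thus match, which
  gives continuity in both directions.\<close>

lemma top_iso_unit:
  assumes ob: "stone_ob n (X, u)"
  shows "top_iso n (X, u) (spec (clop (X, u))) (stone_unit (X, u))"
proof -
  have X: "stone_space X" and obX: "top_ob n (X, u)"
    using ob by (auto simp: stone_ob_def)
  obtain B J where BJ: "clop (X, u) = (B, J)"
    by force
  have obB: "boole_ob n (B, J)"
    using boole_ob_clop[OF obX] BJ by simp
  note B = boole_ob_alg[OF obB]
  have car: "car B = clopens X" and J: "\<And>i. J i = {V \<in> clopens X. V \<subseteq> u i}"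
    using clop_simps(1,7)[of X u] BJ by auto
  let ?e = "stone_unit (X, u)"
  have e: "?e x = {V \<in> clopens X. x \<in> V}" if "x \<in> topspace X" for x
    using that by (simp add: stone_unit_def)
  have eB: "?e x \<in> ultrafilters B" if "x \<in> topspace X" for x
    using point_ultrafilter[OF that, of u] BJ e that by simp
  have surj: "\<exists>x\<in>topspace X. F = ?e x" if F: "F \<in> ultrafilters B" for F
  proof -
    obtain x where "x \<in> topspace X" "F = {V \<in> clopens X. x \<in> V}"
      using ultrafilter_is_point[OF X obX, of F] F BJ by (metis fst_conv)
    then show ?thesis
      using e by blast
  qed
  have in_stone: "?e x \<in> stone_set B V \<longleftrightarrow> x \<in> V" if "x \<in> topspace X" "V \<in> clopens X" for x V
    using that eB e by (simp add: stone_set_def)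
  have "inj_on ?e (topspace X)"
  proof (rule inj_onI)
    fix x y assume xy: "x \<in> topspace X" "y \<in> topspace X" "?e x = ?e y"
    then have "{V \<in> clopens X. x \<in> V} = {V \<in> clopens X. y \<in> V}"
      using e by simp
    then show "x = y"
      using clopen_separation[OF X xy(1,2)] by blast
  qed
  then have bij: "bij_betw ?e (topspace X) (ultrafilters B)"
    using eB surj by (auto simp: bij_betw_def)
  have op: "openin (fst (spec (B, J))) W \<longleftrightarrow> openin X {x \<in> topspace X. ?e x \<in> W}"
    if W: "W \<subseteq> ultrafilters B" for W
  proof
    assume o: "openin (fst (spec (B, J))) W"
    show "openin X {x \<in> topspace X. ?e x \<in> W}"
      unfolding openin_stone_space_iff[OF X]
    proof
      fix x assume "x \<in> {x \<in> topspace X. ?e x \<in> W}"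
      then have x: "x \<in> topspace X" "?e x \<in> W"
        by auto
      then obtain V where V: "V \<in> clopens X" "?e x \<in> stone_set B V" "stone_set B V \<subseteq> W"
        using o unfolding openin_spec_iff[OF B] car by blast
      have "y \<in> topspace X \<and> ?e y \<in> W" if "y \<in> V" for y
        using in_stone[of y V] clopens_closed(6)[OF V(1)] V that by blast
      then have "V \<subseteq> {x \<in> topspace X. ?e x \<in> W}"
        by blast
      then show "\<exists>V\<in>clopens X. x \<in> V \<and> V \<subseteq> {x \<in> topspace X. ?e x \<in> W}"
        using V x in_stone by blast
    qed
  next
    assume o: "openin X {x \<in> topspace X. ?e x \<in> W}"
    show "openin (fst (spec (B, J))) W"
      unfolding openin_spec_iff[OF B] car
    proof (intro conjI ballI W)
      fix F assume F: "F \<in> W"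
      then obtain x where x: "x \<in> topspace X" "F = ?e x"
        using surj W by blast
      then obtain V where V: "V \<in> clopens X" "x \<in> V" "V \<subseteq> {x \<in> topspace X. ?e x \<in> W}"
        using F clopen_base[OF X o, of x] by blast
      have "stone_set B V \<subseteq> W"
      proof
        fix G assume G: "G \<in> stone_set B V"
        then obtain y where "y \<in> topspace X" "G = ?e y"
          using surj[of G] by (auto simp: stone_set_def)
        then show "G \<in> W"
          using in_stone G V by blast
      qed
      then show "\<exists>V\<in>clopens X. F \<in> stone_set B V \<and> stone_set B V \<subseteq> W"
        using V x in_stone by blast
    qed
  qed
  \<comment> \<open>Openness of \<open>u i\<close> is essential: a point of it has a clopen
    neighbourhood inside \<open>u i\<close>, and such a neighbourhood is a common element of
    \<open>?e x\<close> and \<open>J i\<close>.\<close>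
  have o: "?e x \<in> {F \<in> ultrafilters B. F \<inter> J i \<noteq> {}} \<longleftrightarrow> x \<in> u i"
    if i: "i \<in> {1..<n}" and x: "x \<in> topspace X" for i x
  proof -
    have "openin X (u i)"
      using top_obD(1)[OF obX i] .
    then show ?thesis
      unfolding openin_stone_space_iff[OF X] using e[OF x] eB[OF x] by (auto simp: J)
  qed
  have "top_iso n (X, u) (fst (spec (B, J)), \<lambda>i. {F \<in> ultrafilters B. F \<inter> J i \<noteq> {}}) ?e"
  proof (rule top_isoI[OF obX])
    show "top_ob n (fst (spec (B, J)), \<lambda>i. {F \<in> ultrafilters B. F \<inter> J i \<noteq> {}})"
      using stone_ob_spec[OF obB] by (simp add: stone_ob_def spec_simps[symmetric])
    show "?e \<in> extensional (topspace X)"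
      by (simp add: stone_unit_def)
  qed (use bij op o in \<open>simp_all add: topspace_spec[OF B]\<close>)
  then show ?thesis
    by (simp add: spec_simps[symmetric] BJ)
qed

text \<open>At a point \<open>x\<close> of \<open>X\<close>, both sides are the set of clopens of
  \<open>Y\<close> that contain \<open>f x\<close>.\<close>

lemma stone_unit_natural:
  assumes ob: "stone_ob n (X, u)" "stone_ob n (Y, v)" and f: "f \<in> top_hom n (X, u) (Y, v)"
  shows "top_comp (X, u) (stone_unit (Y, v)) f =
    top_comp (X, u) (spec_map (clop (Y, v)) (clop (X, u)) (clop_map (X, u) (Y, v) f)) (stone_unit (X, u))"
proof
  fix x
  have "f x \<in> topspace Y" if "x \<in> topspace X"
    using f that by (auto simp: top_hom_def)
  then show "top_comp (X, u) (stone_unit (Y, v)) f x =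
    top_comp (X, u) (spec_map (clop (Y, v)) (clop (X, u)) (clop_map (X, u) (Y, v) f)) (stone_unit (X, u)) x"
    using point_ultrafilter[of x X u] clop_map_hom[OF f]
    by (auto simp: top_comp_def compose_def stone_unit_def spec_map_def clop_map_def clop_simps
        boole_hom_def case_prod_beta ba_hom_def)
qed

section \<open>The two categories\<close>

lemma boole_hom_PiE: "f \<in> boole_hom n A B \<Longrightarrow> f \<in> car (fst A) \<rightarrow>\<^sub>E car (fst B)"
  by (auto simp: boole_hom_def ba_hom_def split: prod.splits)

lemma top_hom_PiE: "f \<in> top_hom n X Y \<Longrightarrow> f \<in> topspace (fst X) \<rightarrow>\<^sub>E topspace (fst Y)"
  by (auto simp: top_hom_def split: prod.splits)

lemma boole_comp_assoc:
  assumes "f \<in> boole_hom n A B"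
  shows "boole_comp A (boole_comp B h g) f = boole_comp A h (boole_comp A g f)"
  using boole_hom_PiE[OF assms] by (auto simp: boole_comp_def compose_def fun_eq_iff)

lemma top_comp_assoc:
  assumes "f \<in> top_hom n X Y"
  shows "top_comp X (top_comp Y h g) f = top_comp X h (top_comp X g f)"
  using top_hom_PiE[OF assms] by (auto simp: top_comp_def compose_def fun_eq_iff)

lemma boole_comp_id:
  assumes "f \<in> boole_hom n A B"
  shows "boole_comp A f (boole_id A) = f" "boole_comp A (boole_id B) f = f"
  using boole_hom_PiE[OF assms]
  by (auto simp: boole_comp_def boole_id_def compose_def fun_eq_iff PiE_def extensional_def)

lemma top_comp_id:
  assumes "f \<in> top_hom n X Y"
  shows "top_comp X f (top_id X) = f" "top_comp X (top_id Y) f = f"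
  using top_hom_PiE[OF assms]
  by (auto simp: top_comp_def top_id_def compose_def fun_eq_iff PiE_def extensional_def)

lemma boole_hom_id:
  assumes "boole_ob n A"
  shows "boole_id A \<in> boole_hom n A A"
proof -
  obtain B J where A: "A = (B, J)"
    by force
  have "boole_id A \<in> ba_hom B B"
    using ba_closed[OF boole_ob_alg[OF assms[unfolded A]]] by (auto simp: A ba_hom_def boole_id_def)
  moreover have "boole_id A ` J i \<subseteq> J i" if "i \<in> {1..<n}" for i
    using ideal_subset[OF assms[unfolded A] that] by (auto simp: A boole_id_def)
  ultimately show ?thesis
    by (auto simp: A boole_hom_def)
qed

lemma top_hom_id: "top_id X \<in> top_hom n X X"
proof -
  have "continuous_map (fst X) (fst X) (top_id X)"
    unfolding top_id_def by (rule continuous_map_eq[OF continuous_map_id]) simp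
  then show ?thesis
    by (auto simp: top_hom_def top_id_def split: prod.splits)
qed

lemma boole_hom_comp:
  assumes ob: "boole_ob n A" and f: "f \<in> boole_hom n A B" and g: "g \<in> boole_hom n B C"
  shows "boole_comp A g f \<in> boole_hom n A C"
proof -
  obtain A' I B' J C' K where eq: "A = (A', I)" "B = (B', J)" "C = (C', K)"
    by (metis surj_pair)
  have f': "f \<in> ba_hom A' B'" "\<And>i. i \<in> {1..<n} \<Longrightarrow> f ` I i \<subseteq> J i"
    and g': "g \<in> ba_hom B' C'" "\<And>i. i \<in> {1..<n} \<Longrightarrow> g ` J i \<subseteq> K i"
    using f g by (auto simp: eq boole_hom_def)
  have "boole_comp A g f \<in> ba_hom A' C'"
    using ba_hom_simps[OF f'(1)] ba_hom_simps[OF g'(1)] ba_closed[OF boole_ob_alg[OF ob[unfolded eq]]]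
    by (auto simp: eq boole_comp_def compose_def ba_hom_def)
  moreover have "boole_comp A g f ` I i \<subseteq> K i" if i: "i \<in> {1..<n}" for i
    using f'(2)[OF i] g'(2)[OF i] ideal_subset[OF ob[unfolded eq] i]
    by (fastforce simp: eq boole_comp_def compose_def)
  ultimately show ?thesis
    by (auto simp: eq boole_hom_def)
qed

lemma top_hom_comp:
  assumes f: "f \<in> top_hom n X Y" and g: "g \<in> top_hom n Y Z"
  shows "top_comp X g f \<in> top_hom n X Z"
proof -
  obtain X' u Y' v Z' w where eq: "X = (X', u)" "Y = (Y', v)" "Z = (Z', w)"
    by (metis surj_pair)
  have f': "f \<in> topspace X' \<rightarrow>\<^sub>E topspace Y'" "continuous_map X' Y' f"
      "\<And>i. i \<in> {1..<n} \<Longrightarrow> {x \<in> topspace X'. f x \<in> v i} \<subseteq> u i"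
    and g': "g \<in> topspace Y' \<rightarrow>\<^sub>E topspace Z'" "continuous_map Y' Z' g"
      "\<And>i. i \<in> {1..<n} \<Longrightarrow> {x \<in> topspace Y'. g x \<in> w i} \<subseteq> v i"
    using f g by (auto simp: eq top_hom_def)
  have "continuous_map X' Z' (top_comp X g f)"
    by (rule continuous_map_eq[OF continuous_map_compose[OF f'(2) g'(2)]])
      (simp add: eq top_comp_def compose_def)
  moreover have "{x \<in> topspace X'. top_comp X g f x \<in> w i} \<subseteq> u i" if i: "i \<in> {1..<n}" for i
    using f'(1) f'(3)[OF i] g'(3)[OF i] by (auto simp: eq top_comp_def compose_def)
  moreover have "top_comp X g f \<in> topspace X' \<rightarrow>\<^sub>E topspace Z'"
    using f'(1) g'(1) by (auto simp: eq top_comp_def compose_def)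
  ultimately show ?thesis
    by (auto simp: eq top_hom_def)
qed

section \<open>The category laws\<close>

lemma Boole_cat_simps:
  "Ob (Boole_cat n U) = {A. boole_ob n A \<and> car (fst A) \<in> U}" "Hom (Boole_cat n U) = boole_hom n"
  "Id (Boole_cat n U) = boole_id" "Comp (Boole_cat n U) = (\<lambda>A B C. boole_comp A)"
  by (simp_all add: Boole_cat_def)

lemma Stone_cat_simps:
  "Ob (Stone_cat n U) = {X. stone_ob n X \<and> topspace (fst X) \<in> U}" "Hom (Stone_cat n U) = top_hom n"
  "Id (Stone_cat n U) = top_id" "Comp (Stone_cat n U) = (\<lambda>X Y Z. top_comp X)"
  by (auto simp: Stone_cat_def Top_cat_def full_subcategory_def stone_ob_def)

lemma opposite_simps:
  "Ob (opposite C) = Ob C" "Hom (opposite C) = (\<lambda>X Y. Hom C Y X)" "Id (opposite C) = Id C"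
  "Comp (opposite C) = (\<lambda>X Y Z g f. Comp C Z Y X f g)"
  by (simp_all add: opposite_def)

lemma category_Boole_cat: "category (Boole_cat n U)"
  unfolding category_def Boole_cat_simps
  by (intro conjI ballI)
    (auto intro: boole_hom_id boole_hom_comp boole_comp_id boole_comp_assoc)

lemma category_Stone_cat: "category (Stone_cat n U)"
  unfolding category_def Stone_cat_simps
  by (intro conjI ballI) (auto intro: top_hom_id top_hom_comp top_comp_id top_comp_assoc)

lemma category_opposite:
  assumes "category C"
  shows "category (opposite C)"
  using assms unfolding category_def opposite_simps by simp

section \<open>Composition of isomorphisms and their images under the clopen functor\<close>

lemma boole_iso_trans:
  assumes ob: "boole_ob n A" "boole_ob n C"
    and f: "boole_iso n A B f" and g: "boole_iso n B C g"
  shows "boole_iso n A C (boole_comp A g f)"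
proof -
  obtain f' where f': "f \<in> boole_hom n A B" "f' \<in> boole_hom n B A"
    "boole_comp A f' f = boole_id A" "boole_comp B f f' = boole_id B"
    using f by (auto simp: boole_iso_def)
  obtain g' where g': "g \<in> boole_hom n B C" "g' \<in> boole_hom n C B"
    "boole_comp B g' g = boole_id B" "boole_comp C g g' = boole_id C"
    using g by (auto simp: boole_iso_def)
  have "boole_comp A (boole_comp C f' g') (boole_comp A g f) = boole_id A"
  proof -
    have "boole_comp A (boole_comp C f' g') (boole_comp A g f)
      = boole_comp A (boole_comp B (boole_comp C f' g') g) f"
      using boole_comp_assoc[OF f'(1)] by metis
    also have "\<dots> = boole_comp A f' f"
      using boole_comp_assoc[OF g'(1), of f' g'] g'(3) boole_comp_id(1)[OF f'(2)] by simp
    finally show ?thesis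
      using f'(3) by simp
  qed
  moreover have "boole_comp C (boole_comp A g f) (boole_comp C f' g') = boole_id C"
  proof -
    have "boole_comp C (boole_comp A g f) (boole_comp C f' g')
      = boole_comp C (boole_comp B (boole_comp A g f) f') g'"
      using boole_comp_assoc[OF g'(2)] by metis
    also have "\<dots> = boole_comp C g g'"
      using boole_comp_assoc[OF f'(2), of g f] f'(4) boole_comp_id(1)[OF g'(1)] by simp
    finally show ?thesis
      using g'(4) by simp
  qed
  ultimately show ?thesis
    using boole_hom_comp[OF ob(1) f'(1) g'(1)] boole_hom_comp[OF ob(2) g'(2) f'(2)]
    unfolding boole_iso_def by blast
qed

lemma boole_iso_clop_map:
  assumes "top_iso n (X, u) (Y, v) f"
  shows "boole_iso n (clop (Y, v)) (clop (X, u)) (clop_map (X, u) (Y, v) f)"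
proof -
  obtain g where f: "f \<in> top_hom n (X, u) (Y, v)" and g: "g \<in> top_hom n (Y, v) (X, u)"
    and inv: "top_comp (X, u) g f = top_id (X, u)" "top_comp (Y, v) f g = top_id (Y, v)"
    using assms by (auto simp: top_iso_def)
  have "boole_comp (clop (Y, v)) (clop_map (Y, v) (X, u) g) (clop_map (X, u) (Y, v) f) = boole_id (clop (Y, v))"
    "boole_comp (clop (X, u)) (clop_map (X, u) (Y, v) f) (clop_map (Y, v) (X, u) g) = boole_id (clop (X, u))"
    using clop_map_comp[OF f g] clop_map_comp[OF g f] inv clop_map_id by metis+
  then show ?thesis
    using clop_map_hom[OF f] clop_map_hom[OF g] unfolding boole_iso_def by blast
qed

section \<open>Full faithfulness of the clopen algebra functor\<close>

text \<open>The map on clopens determines which clopen sets contain \<open>f x\<close>, and these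
  determine the point.\<close>

lemma clop_map_faithful:
  assumes Y: "stone_space Y" and f: "f \<in> top_hom n (X, u) (Y, v)" and g: "g \<in> top_hom n (X, u) (Y, v)"
    and eq: "clop_map (X, u) (Y, v) f = clop_map (X, u) (Y, v) g"
  shows "f = g"
proof
  fix x
  show "f x = g x"
  proof (cases "x \<in> topspace X")
    case True
    show ?thesis
    proof (rule clopen_separation[OF Y])
      show "f x \<in> topspace Y" "g x \<in> topspace Y"
        using top_hom_PiE[OF f] top_hom_PiE[OF g] True by auto
      fix V assume "V \<in> clopens Y"
      then show "f x \<in> V \<longleftrightarrow> g x \<in> V"
        using fun_cong[OF eq, of V] True by (auto simp: clop_map_def)
    qed
  next
    case False
    then show ?thesis
      using top_hom_PiE[OF f] top_hom_PiE[OF g] by (auto simp: PiE_def extensional_def)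
  qed
qed

text \<open>Pulling the ultrafilter of a point \<open>x\<close> back along \<open>\<phi>\<close>
  gives an ultrafilter of clopens of \<open>Y\<close>. It is the ultrafilter of a point, and that
  point is taken as \<open>f x\<close>.\<close>

lemma clop_map_full:
  assumes X: "stone_ob n (X, u)" and Y: "stone_ob n (Y, v)"
    and \<phi>: "\<phi> \<in> boole_hom n (clop (Y, v)) (clop (X, u))"
  obtains f where "f \<in> top_hom n (X, u) (Y, v)" "clop_map (X, u) (Y, v) f = \<phi>"
proof -
  have obX: "top_ob n (X, u)" and sX: "stone_space X" and obY: "top_ob n (Y, v)" and sY: "stone_space Y"
    using X Y by (auto simp: stone_ob_def)
  have hom: "\<phi> \<in> ba_hom (fst (clop (Y, v))) (fst (clop (X, u)))"
    and ideals: "\<And>i. i \<in> {1..<n} \<Longrightarrow> \<phi> ` snd (clop (Y, v)) i \<subseteq> snd (clop (X, u)) i"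
    using \<phi> by (auto simp: boole_hom_def case_prod_beta)
  have \<phi>c: "\<phi> V \<in> clopens X" if "V \<in> clopens Y" for V
    using ba_hom_simps(1)[OF hom] that by (simp add: clop_simps)
  have alg: "boolean_alg (fst (clop (X, u)))" "boolean_alg (fst (clop (Y, v)))"
    using boole_ob_clop[OF obX] boole_ob_clop[OF obY] boole_obD(1) by (metis prod.collapse)+
  have "\<exists>y\<in>topspace Y. \<forall>V\<in>clopens Y. y \<in> V \<longleftrightarrow> x \<in> \<phi> V" if x: "x \<in> topspace X" for x
  proof -
    have "{V \<in> clopens Y. \<phi> V \<in> {W \<in> clopens X. x \<in> W}} \<in> ultrafilters (fst (clop (Y, v)))"
      using ultrafilter_preimage[OF alg(2,1) hom point_ultrafilter[OF x]] by (simp add: clop_simps)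
    then obtain y where "y \<in> topspace Y"
      "{V \<in> clopens Y. \<phi> V \<in> {W \<in> clopens X. x \<in> W}} = {V \<in> clopens Y. y \<in> V}"
      by (rule ultrafilter_is_point[OF sY obY])
    then show ?thesis
      using \<phi>c by (intro bexI[of _ y]) blast+
  qed
  then obtain f0 where f0: "\<And>x. x \<in> topspace X \<Longrightarrow> f0 x \<in> topspace Y"
    "\<And>x V. x \<in> topspace X \<Longrightarrow> V \<in> clopens Y \<Longrightarrow> f0 x \<in> V \<longleftrightarrow> x \<in> \<phi> V"
    by metis
  define f where "f = restrict f0 (topspace X)"
  have f: "\<And>x. x \<in> topspace X \<Longrightarrow> f x \<in> topspace Y"
    "\<And>x V. x \<in> topspace X \<Longrightarrow> V \<in> clopens Y \<Longrightarrow> f x \<in> V \<longleftrightarrow> x \<in> \<phi> V"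
    using f0 by (auto simp: f_def)
  have pre: "{x \<in> topspace X. f x \<in> V} = \<phi> V" if "V \<in> clopens Y" for V
    using f(2) that clopens_closed(6)[OF \<phi>c[OF that]] by blast
  have "openin X {x \<in> topspace X. f x \<in> W}" if W: "openin Y W" for W
    unfolding openin_stone_space_iff[OF sX]
  proof
    fix x assume "x \<in> {x \<in> topspace X. f x \<in> W}"
    then obtain V where "V \<in> clopens Y" "f x \<in> V" "V \<subseteq> W" "x \<in> topspace X"
      using clopen_base[OF sY W, of "f x"] by blast
    then show "\<exists>V\<in>clopens X. x \<in> V \<and> V \<subseteq> {x \<in> topspace X. f x \<in> W}"
      using pre[of V] \<phi>c[of V] by (intro bexI[of _ "\<phi> V"]) auto
  qed
  then have "continuous_map X Y f"
    using f(1) by (auto simp: continuous_map_def)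
  moreover have "{x \<in> topspace X. f x \<in> v i} \<subseteq> u i" if i: "i \<in> {1..<n}" for i
  proof
    fix x assume x: "x \<in> {x \<in> topspace X. f x \<in> v i}"
    then obtain V where V: "V \<in> clopens Y" "f x \<in> V" "V \<subseteq> v i"
      using clopen_base[OF sY top_obD(1)[OF obY i], of "f x"] by blast
    \<comment> \<open>\<open>V\<close> belongs to the \<open>i\<close>-th ideal of the clopen
      algebra of \<open>Y\<close>, and \<open>\<phi>\<close> respects these ideals.\<close>
    then have "\<phi> V \<subseteq> u i"
      using ideals[OF i] by (auto simp: clop_simps)
    then show "x \<in> u i"
      using pre[OF V(1)] V(2) x by blast
  qed
  ultimately have "f \<in> top_hom n (X, u) (Y, v)"
    using f(1) by (auto simp: top_hom_def f_def)
  moreover have "clop_map (X, u) (Y, v) f = \<phi>"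
  proof
    fix V
    show "clop_map (X, u) (Y, v) f V = \<phi> V"
      using pre[of V] boole_hom_PiE[OF \<phi>]
      by (cases "V \<in> clopens Y") (auto simp: clop_map_def clop_simps PiE_def extensional_def)
  qed
  ultimately show ?thesis
    using that by blast
qed

section \<open>Transport along injections\<close>

lemma stone_space_top_iso:
  assumes iso: "top_iso n (Y, v) (X, u) f" and X: "stone_space X"
  shows "stone_space Y"
proof -
  obtain g where f: "f \<in> top_hom n (Y, v) (X, u)" and g: "g \<in> top_hom n (X, u) (Y, v)"
    and inv: "top_comp (Y, v) g f = top_id (Y, v)" "top_comp (X, u) f g = top_id (X, u)"
    using iso by (auto simp: top_iso_def)
  have cf: "continuous_map Y X f" and cg: "continuous_map X Y g"
    using f g by (auto simp: top_hom_def)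
  have gf: "g (f y) = y" if "y \<in> topspace Y" for y
    using fun_cong[OF inv(1), of y] that by (simp add: top_comp_def top_id_def compose_def)
  have fg: "f (g x) = x" if "x \<in> topspace X" for x
    using fun_cong[OF inv(2), of x] that by (simp add: top_comp_def top_id_def compose_def)
  have "homeomorphic_maps Y X f g"
    using cf cg fg gf by (simp add: homeomorphic_maps_def)
  then have h: "Y homeomorphic_space X"
    unfolding homeomorphic_space_def by blast
  have "neighbourhood_base_of (\<lambda>V. V \<in> clopens Y) Y"
    unfolding neighbourhood_base_of
  proof (intro allI impI, elim conjE)
    fix W y assume W: "openin Y W" "y \<in> W"
    then have y: "y \<in> topspace Y"
      using openin_subset by blast
    have "openin X {x \<in> topspace X. g x \<in> W}"
      using cg W by (simp add: openin_continuous_map_preimage)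
    moreover have fy: "f y \<in> topspace X"
      using cf y by (auto simp: continuous_map_def)
    ultimately obtain V where V: "V \<in> clopens X" "f y \<in> V" "V \<subseteq> {x \<in> topspace X. g x \<in> W}"
      using clopen_base[OF X, of "{x \<in> topspace X. g x \<in> W}" "f y"] gf[OF y] W by auto
    let ?V = "{y \<in> topspace Y. f y \<in> V}"
    have "openin Y ?V" "closedin Y ?V"
      using V cf openin_continuous_map_preimage closedin_continuous_map_preimage
      by (auto simp: clopens_def)
    moreover have "?V \<subseteq> W"
      using V gf by fastforce
    ultimately show "\<exists>U V. openin Y U \<and> V \<in> clopens Y \<and> y \<in> U \<and> U \<subseteq> V \<and> V \<subseteq> W"
      using y V by (intro exI[of _ ?V]) (auto simp: clopens_def)
  qed
  then show ?thesis
    using X homeomorphic_compact_space[OF h] homeomorphic_Hausdorff_space[OF h]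
    by (simp add: stone_space_def)
qed

lemma stone_ob_transport:
  assumes ob: "stone_ob n (X, u)" and h: "inj_on h (topspace X)"
  obtains Y v f where "stone_ob n (Y, v)" "topspace Y = h ` topspace X" "top_iso n (Y, v) (X, u) f"
proof -
  let ?S = "h ` topspace X"
  let ?k = "inv_into (topspace X) h"
  \<comment> \<open>Pulling back along the inverse of \<open>h\<close> on its image makes that
    inverse a homeomorphism onto \<open>X\<close>.\<close>
  define Y where "Y = pullback_topology ?S ?k X"
  define v where "v i = h ` u i" for i
  have obX: "top_ob n (X, u)" and sX: "stone_space X"
    using ob by (auto simp: stone_ob_def)
  note sub = openin_subset[OF top_obD(1)[OF obX]]
  have kh: "?k (h x) = x" if "x \<in> topspace X" for x
    using h that by simp
  have top: "topspace Y = ?S"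
    by (auto simp: Y_def topspace_pullback_topology kh)
  have op: "openin Y {y \<in> ?S. ?k y \<in> W} \<longleftrightarrow> openin X W" if W: "W \<subseteq> topspace X" for W
  proof
    assume "openin Y {y \<in> ?S. ?k y \<in> W}"
    then obtain V where V: "openin X V" "{y \<in> ?S. ?k y \<in> W} = ?k -` V \<inter> ?S"
      by (auto simp: Y_def openin_pullback_topology)
    have "x \<in> W \<longleftrightarrow> x \<in> V" if x: "x \<in> topspace X" for x
      using eqset_imp_iff[OF V(2), of "h x"] x kh[OF x] by auto
    then have "W = V"
      using W openin_subset[OF V(1)] by blast
    then show "openin X W"
      using V by simp
  qed (auto simp: Y_def openin_pullback_topology)
  \<comment> \<open>The image is rewritten as a preimage, since preimages commute with the
    intersections in condition (ii).\<close>
  have v: "v i = {y \<in> ?S. ?k y \<in> u i}" if "i \<in> {1..<n}" for i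
    using sub[OF that] kh by (force simp: v_def)
  have "top_ob n (Y, v)"
    unfolding top_ob_def prod.case
  proof (intro conjI ballI)
    fix i assume i: "i \<in> {1..<n}"
    show "openin Y (v i)"
      using op[OF sub[OF i]] top_obD(1)[OF obX i] v[OF i] by simp
    show "v i = v (n - i)"
      unfolding v_def using top_obD(2)[OF obX i] by simp
  next
    fix i j assume i: "i \<in> {2..<n}" and j: "j \<in> {1..<i}"
    then have ij: "j \<in> {1..<n}" "i - j \<in> {1..<n}" "i \<in> {1..<n}"
      by auto
    show "v j \<inter> v (i - j) \<subseteq> v i"
      unfolding v[OF ij(1)] v[OF ij(2)] v[OF ij(3)] using top_obD(3)[OF obX i j] by blast
  qed
  moreover have iso: "top_iso n (Y, v) (X, u) (restrict ?k ?S)"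
  proof (rule top_isoI[OF calculation obX])
    show "restrict ?k ?S \<in> extensional (topspace Y)"
      by (simp add: top)
    show "bij_betw (restrict ?k ?S) (topspace Y) (topspace X)"
      using bij_betw_inv_into[OF inj_on_imp_bij_betw[OF h]] by (simp add: top)
    show "openin X W \<longleftrightarrow> openin Y {y \<in> topspace Y. restrict ?k ?S y \<in> W}"
      if "W \<subseteq> topspace X" for W
    proof -
      have "{y \<in> topspace Y. restrict ?k ?S y \<in> W} = {y \<in> ?S. ?k y \<in> W}"
        by (auto simp: top)
      then show ?thesis
        using op[OF that] by simp
    qed
    show "restrict ?k ?S y \<in> u i \<longleftrightarrow> y \<in> v i" if "i \<in> {1..<n}" "y \<in> topspace Y" for i y
      using that v by (auto simp: top)
  qed
  ultimately show ?thesis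
    using that top stone_space_top_iso[OF iso sX] by (simp add: stone_ob_def)
qed

lemma boole_ob_transport:
  assumes ob: "boole_ob n (B, J)" and h: "inj_on h (car B)"
  obtains A I f where "boole_ob n (A, I)" "car A = h ` car B" "boole_iso n (A, I) (B, J) f"
proof -
  let ?k = "inv_into (car B) h"
  note B = boole_ob_alg[OF ob]
  define A where "A = \<lparr>car = h ` car B, join = (\<lambda>x y. h (join B (?k x) (?k y))),
    meet = (\<lambda>x y. h (meet B (?k x) (?k y))), cmp = (\<lambda>x. h (cmp B (?k x))),
    zer = h (zer B), unt = h (unt B)\<rparr>"
  define I where "I i = h ` J i" for i
  have A_simps: "car A = h ` car B" "join A = (\<lambda>x y. h (join B (?k x) (?k y)))"
    "meet A = (\<lambda>x y. h (meet B (?k x) (?k y)))" "cmp A = (\<lambda>x. h (cmp B (?k x)))"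
    "zer A = h (zer B)" "unt A = h (unt B)"
    by (simp_all add: A_def)
  have kh: "?k (h x) = x" if "x \<in> car B" for x
    using h that by simp
  have alg: "boolean_alg A"
    unfolding boolean_alg_def A_simps ball_simps
    by (auto simp: kh ba_closed[OF B] ba_neutral[OF B]; rule arg_cong[where f = h],
        (rule ba_assoc[OF B] | rule ba_commute[OF B] | rule ba_distrib[OF B]); assumption)
  have "boole_ob n (A, I)"
    unfolding boole_ob_def prod.case
  proof (intro conjI ballI alg)
    fix i assume i: "i \<in> {1..<n}"
    note id = boole_obD(2)[OF ob i]
    have x: "x \<in> car B" if "x \<in> J i" for x
      using that ideal_subset[OF ob i] by blast
    show "ba_ideal A (I i)"
      using id x unfolding ba_ideal_def A_simps I_def by (auto simp: kh x)
    show "I i = I (n - i)"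
      unfolding I_def using boole_obD(3)[OF ob i] by simp
  next
    fix i j assume i: "i \<in> {2..<n}" and j: "j \<in> {1..<i}"
    then have ij: "j \<in> {1..<n}" "i - j \<in> {1..<n}"
      by auto
    have "I j \<inter> I (i - j) = h ` (J j \<inter> J (i - j))"
      unfolding I_def using inj_on_image_Int[OF h ideal_subset[OF ob ij(1)] ideal_subset[OF ob ij(2)]]
      by simp
    then show "I j \<inter> I (i - j) \<subseteq> I i"
      unfolding I_def using boole_obD(4)[OF ob i j] by blast
  qed
  moreover have "boole_iso n (A, I) (B, J) (restrict ?k (h ` car B))"
  proof (rule boole_isoI[OF calculation ob])
    show "restrict ?k (h ` car B) \<in> ba_hom A B"
      unfolding ba_hom_def A_simps by (auto simp: kh ba_closed[OF B])
    show "bij_betw (restrict ?k (h ` car B)) (car A) (car B)"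
      using bij_betw_inv_into[OF inj_on_imp_bij_betw[OF h]] by (simp add: A_simps)
    show "restrict ?k (h ` car B) x \<in> J i \<longleftrightarrow> x \<in> I i" if "i \<in> {1..<n}" "x \<in> car A" for i x
    proof -
      obtain b where b: "b \<in> car B" "x = h b"
        using \<open>x \<in> car A\<close> by (auto simp: A_simps)
      then show ?thesis
        using inj_on_image_mem_iff[OF h b(1) ideal_subset[OF ob that(1)]] kh by (simp add: I_def)
    qed
  qed
  ultimately show ?thesis
    using that A_simps(1) by blast
qed

text \<open>Both constructions fit this form: ultrafilters are subsets of the carrier, and clopens
  are subsets of the space. Power sets supply the injection, and closure under subsets makes its
  image small.\<close>

lemma universe_inj:
  assumes U: "universe U" and S: "S \<in> U" and T: "T \<subseteq> Pow S"
  obtains h where "inj_on h T" "h ` T \<in> U"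
proof -
  obtain S' where "S' \<in> U" "Pow S \<approx> S'"
    using U S unfolding universe_def by blast
  then obtain h where "bij_betw h (Pow S) S'"
    by (auto simp: eqpoll_def)
  then have "inj_on h (Pow S)" "h ` T \<subseteq> S'"
    using T by (auto simp: bij_betw_def)
  then show ?thesis
    using that U \<open>S' \<in> U\<close> T unfolding universe_def by (meson inj_on_subset)
qed

section \<open>Equivalence from a span of objects\<close>

lemma categoryD:
  assumes "category C"
  shows "X \<in> Ob C \<Longrightarrow> Id C X \<in> Hom C X X"
    "X \<in> Ob C \<Longrightarrow> Y \<in> Ob C \<Longrightarrow> Z \<in> Ob C \<Longrightarrow> f \<in> Hom C X Y \<Longrightarrow> g \<in> Hom C Y Z \<Longrightarrow>
      Comp C X Y Z g f \<in> Hom C X Z"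
    "X \<in> Ob C \<Longrightarrow> Y \<in> Ob C \<Longrightarrow> f \<in> Hom C X Y \<Longrightarrow> Comp C X X Y f (Id C X) = f"
    "X \<in> Ob C \<Longrightarrow> Y \<in> Ob C \<Longrightarrow> f \<in> Hom C X Y \<Longrightarrow> Comp C X Y Y (Id C Y) f = f"
  using assms by (simp_all add: category_def)

text \<open>A choice-free presentation of an equivalence: a set \<open>P\<close> of indices covering the objects of
  both categories, and a relation between arrows that is bijective on hom-sets and respects
  identities and composition. Functors arise by choosing an index above each object.\<close>

locale equivalence_span =
  fixes C :: "('o, 'm) cat" and D :: "('p, 'q) cat" and P :: "'i set"
    and a :: "'i \<Rightarrow> 'o" and b :: "'i \<Rightarrow> 'p" and R :: "'i \<Rightarrow> 'i \<Rightarrow> 'm \<Rightarrow> 'q \<Rightarrow> bool"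
  assumes categories: "category C" "category D"
    and objects: "\<And>p. p \<in> P \<Longrightarrow> a p \<in> Ob C" "\<And>p. p \<in> P \<Longrightarrow> b p \<in> Ob D"
    and cover: "\<And>A. A \<in> Ob C \<Longrightarrow> \<exists>p\<in>P. a p = A" "\<And>X. X \<in> Ob D \<Longrightarrow> \<exists>p\<in>P. b p = X"
    and right_unique: "\<And>p q f. p \<in> P \<Longrightarrow> q \<in> P \<Longrightarrow> f \<in> Hom C (a p) (a q) \<Longrightarrow>
      \<exists>!g. g \<in> Hom D (b p) (b q) \<and> R p q f g"
    and left_unique: "\<And>p q g. p \<in> P \<Longrightarrow> q \<in> P \<Longrightarrow> g \<in> Hom D (b p) (b q) \<Longrightarrow>
      \<exists>!f. f \<in> Hom C (a p) (a q) \<and> R p q f g"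
    and R_id: "\<And>p. p \<in> P \<Longrightarrow> R p p (Id C (a p)) (Id D (b p))"
    and R_comp: "\<And>p q r f g f' g'. p \<in> P \<Longrightarrow> q \<in> P \<Longrightarrow> r \<in> P \<Longrightarrow>
      f \<in> Hom C (a p) (a q) \<Longrightarrow> g \<in> Hom D (b p) (b q) \<Longrightarrow> R p q f g \<Longrightarrow>
      f' \<in> Hom C (a q) (a r) \<Longrightarrow> g' \<in> Hom D (b q) (b r) \<Longrightarrow> R q r f' g' \<Longrightarrow>
      R p r (Comp C (a p) (a q) (a r) f' f) (Comp D (b p) (b q) (b r) g' g)"
begin

text \<open>The hypotheses are symmetric, so what is proved for one functor and one unit transfers
  to the others by exchanging the categories.\<close>

lemma converse_span: "equivalence_span D C P b a (\<lambda>p q g f. R p q f g)"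
  by unfold_locales
    (use categories objects cover right_unique left_unique R_id R_comp in \<open>simp_all\<close>)

definition push :: "'i \<Rightarrow> 'i \<Rightarrow> 'm \<Rightarrow> 'q" where
  "push p q f = (THE g. g \<in> Hom D (b p) (b q) \<and> R p q f g)"

definition pull :: "'i \<Rightarrow> 'i \<Rightarrow> 'q \<Rightarrow> 'm" where
  "pull p q g = (THE f. f \<in> Hom C (a p) (a q) \<and> R p q f g)"

lemma push:
  assumes "p \<in> P" "q \<in> P" "f \<in> Hom C (a p) (a q)"
  shows "push p q f \<in> Hom D (b p) (b q)" "R p q f (push p q f)"
  using theI'[OF right_unique[OF assms]] by (simp_all add: push_def)

lemma push_eq:
  assumes "p \<in> P" "q \<in> P" "f \<in> Hom C (a p) (a q)" "g \<in> Hom D (b p) (b q)" "R p q f g"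
  shows "push p q f = g"
  unfolding push_def using right_unique[OF assms(1-3)] assms(4,5) by (intro the1_equality) auto

lemma pull:
  assumes "p \<in> P" "q \<in> P" "g \<in> Hom D (b p) (b q)"
  shows "pull p q g \<in> Hom C (a p) (a q)" "R p q (pull p q g) g"
  using theI'[OF left_unique[OF assms]] by (simp_all add: pull_def)

lemma left_eq:
  assumes "p \<in> P" "q \<in> P" "g \<in> Hom D (b p) (b q)" "f \<in> Hom C (a p) (a q)" "f' \<in> Hom C (a p) (a q)"
    "R p q f g" "R p q f' g"
  shows "f = f'"
  using left_unique[OF assms(1-3)] assms by blast

lemma id_in:
  "p \<in> P \<Longrightarrow> Id C (a p) \<in> Hom C (a p) (a p)" "p \<in> P \<Longrightarrow> Id D (b p) \<in> Hom D (b p) (b p)"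
  using categories objects by (simp_all add: categoryD)

lemma comp_in:
  assumes "p \<in> P" "q \<in> P" "r \<in> P" "f \<in> Hom C (a p) (a q)" "f' \<in> Hom C (a q) (a r)"
  shows "Comp C (a p) (a q) (a r) f' f \<in> Hom C (a p) (a r)"
  using categoryD(2)[OF categories(1)] assms objects by blast

lemma comp_id:
  assumes "p \<in> P" "q \<in> P" "g \<in> Hom D (b p) (b q)"
  shows "Comp D (b p) (b p) (b q) g (Id D (b p)) = g" "Comp D (b p) (b q) (b q) (Id D (b q)) g = g"
  using categories assms objects by (simp_all add: categoryD)

text \<open>\<open>s\<close> picks one index above each object of \<open>C\<close>. Each functor law
  holds because the candidate arrow is related to the same arrow of \<open>C\<close> and
  \<open>push\<close> is the only such arrow.\<close>

lemma functor_push: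
  assumes s: "\<And>A. A \<in> Ob C \<Longrightarrow> s A \<in> P \<and> a (s A) = A"
  shows "is_functor C D (\<lambda>A. b (s A), \<lambda>A B. push (s A) (s B))"
  unfolding is_functor_def prod.case
proof (intro conjI ballI)
  show "b (s A) \<in> Ob D" if "A \<in> Ob C" for A
    using s[OF that] objects by simp
  show "push (s A) (s A) (Id C A) = Id D (b (s A))" if "A \<in> Ob C" for A
    using push_eq[of "s A" "s A" "Id C A"] s[OF that] id_in[of "s A"] R_id[of "s A"] by simp
  show "push (s A) (s B) f \<in> Hom D (b (s A)) (b (s B))"
    if "A \<in> Ob C" "B \<in> Ob C" "f \<in> Hom C A B" for A B f
    using push(1) s that by simp
  fix A B E f g
  assume A: "A \<in> Ob C" "B \<in> Ob C" "E \<in> Ob C" and f: "f \<in> Hom C A B" and g: "g \<in> Hom C B E"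
  note sA = s[OF A(1)] and sB = s[OF A(2)] and sE = s[OF A(3)]
  show "push (s A) (s E) (Comp C A B E g f)
    = Comp D (b (s A)) (b (s B)) (b (s E)) (push (s B) (s E) g) (push (s A) (s B) f)"
    using push_eq[of "s A" "s E" "Comp C A B E g f"] comp_in[of "s A" "s B" "s E"]
      R_comp[of "s A" "s B" "s E" f "push (s A) (s B) f" g "push (s B) (s E) g"]
      push[of "s A" "s B" f] push[of "s B" "s E" g] categoryD(2)[OF categories(2)] objects(2) sA sB sE f g by simp
qed

text \<open>Two indices with the same object in \<open>D\<close> may have different objects in
  \<open>C\<close>. Pulling back the identity in both directions gives arrows whose composites are
  again related to the identity, so uniqueness makes them identities. These isomorphisms are the
  components of the unit.\<close>

lemma iso_pull_id:
  assumes p: "p \<in> P" "q \<in> P" and eq: "b q = b p"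
  shows "is_iso C (a p) (a q) (pull p q (Id D (b p)))"
proof -
  let ?i = "Id D (b p)"
  have i: "?i \<in> Hom D (b p) (b p)" "Comp D (b p) (b p) (b p) ?i ?i = ?i"
    using id_in(2)[OF p(1)] comp_id(1)[OF p(1) p(1)] by auto
  note f = pull[OF p, of ?i] and g = pull[OF p(2,1), of ?i]
  have f': "pull p q ?i \<in> Hom C (a p) (a q)" "R p q (pull p q ?i) ?i"
    and g': "pull q p ?i \<in> Hom C (a q) (a p)" "R q p (pull q p ?i) ?i"
    using f g i(1) eq by auto
  have "Comp C (a p) (a q) (a p) (pull q p ?i) (pull p q ?i) = Id C (a p)"
    by (rule left_eq[of p p ?i])
      (use p i f' g' eq comp_in id_in(1) R_id R_comp[of p q p "pull p q ?i" ?i "pull q p ?i" ?i] in simp_all)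
  moreover have "Comp C (a q) (a p) (a q) (pull p q ?i) (pull q p ?i) = Id C (a q)"
    by (rule left_eq[of q q ?i])
      (use p i f' g' eq comp_in id_in(1) R_id[of q] R_comp[of q p q "pull q p ?i" ?i "pull p q ?i" ?i]
        in simp_all)
  ultimately show ?thesis
    using f' g' unfolding is_iso_def by blast
qed

text \<open>The round trip from \<open>A\<close> ends at the index \<open>t (b (s A))\<close>, which
  can differ from \<open>s A\<close> but has the same object in \<open>D\<close>. Naturality holds
  because both sides of the square are related to \<open>push (s A) (s B) f\<close>.\<close>

lemma unit_pull_push:
  assumes s: "\<And>A. A \<in> Ob C \<Longrightarrow> s A \<in> P \<and> a (s A) = A"
    and t: "\<And>X. X \<in> Ob D \<Longrightarrow> t X \<in> P \<and> b (t X) = X"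
  shows "naturally_isomorphic C C id_functor
    (comp_functor (\<lambda>X. a (t X), \<lambda>X Y. pull (t X) (t Y)) (\<lambda>A. b (s A), \<lambda>A B. push (s A) (s B)))"
proof -
  let ?r = "\<lambda>A. t (b (s A))"
  let ?\<eta> = "\<lambda>A. pull (s A) (?r A) (Id D (b (s A)))"
  have r: "?r A \<in> P" "b (?r A) = b (s A)" if "A \<in> Ob C" for A
    using t[OF objects(2)] s[OF that] by auto
  have "is_iso C A (a (?r A)) (?\<eta> A)" if "A \<in> Ob C" for A
    using iso_pull_id[of "s A" "?r A"] s[OF that] r[OF that] by simp
  moreover have "Comp C A B (a (?r B)) (?\<eta> B) f
      = Comp C A (a (?r A)) (a (?r B)) (pull (?r A) (?r B) (push (s A) (s B) f)) (?\<eta> A)"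
    if A: "A \<in> Ob C" "B \<in> Ob C" and f: "f \<in> Hom C A B" for A B f
  proof -
    note sA = s[OF A(1)] and sB = s[OF A(2)] and rA = r[OF A(1)] and rB = r[OF A(2)]
    let ?g = "push (s A) (s B) f"
    have g: "?g \<in> Hom D (b (s A)) (b (s B))" "R (s A) (s B) f ?g"
      using push[of "s A" "s B" f] sA sB f by auto
    have h: "pull (?r A) (?r B) ?g \<in> Hom C (a (?r A)) (a (?r B))" "R (?r A) (?r B) (pull (?r A) (?r B) ?g) ?g"
      using pull[of "?r A" "?r B" ?g] g rA rB by auto
    have \<eta>: "?\<eta> A \<in> Hom C A (a (?r A))" "R (s A) (?r A) (?\<eta> A) (Id D (b (s A)))" if "A \<in> Ob C" for A
      using pull[of "s A" "?r A" "Id D (b (s A))"] id_in(2)[of "s A"] s[OF that] r[OF that] by auto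
    have "R (s A) (?r B) (Comp C A B (a (?r B)) (?\<eta> B) f) ?g"
      using R_comp[of "s A" "s B" "?r B" f ?g "?\<eta> B" "Id D (b (s B))"] \<eta>[OF A(2)] g f sA sB rB
        id_in(2)[of "s B"] comp_id(2)[of "s A" "s B" ?g] by simp
    moreover have "R (s A) (?r B) (Comp C A (a (?r A)) (a (?r B)) (pull (?r A) (?r B) ?g) (?\<eta> A)) ?g"
      using R_comp[of "s A" "?r A" "?r B" "?\<eta> A" "Id D (b (s A))" "pull (?r A) (?r B) ?g" ?g]
        \<eta>[OF A(1)] g h sA sB rA rB id_in(2)[of "s A"] comp_id(1)[of "s A" "s B" ?g] by simp
    moreover have "Comp C A B (a (?r B)) (?\<eta> B) f \<in> Hom C A (a (?r B))"
      using comp_in[of "s A" "s B" "?r B" f "?\<eta> B"] \<eta>[OF A(2)] f sA sB rB by simp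
    moreover have "Comp C A (a (?r A)) (a (?r B)) (pull (?r A) (?r B) ?g) (?\<eta> A) \<in> Hom C A (a (?r B))"
      using comp_in[of "s A" "?r A" "?r B" "?\<eta> A" "pull (?r A) (?r B) ?g"] \<eta>[OF A(1)] h sA rA rB
      by simp
    ultimately show ?thesis
      using left_eq[of "s A" "?r B" ?g] g sA rB by simp
  qed
  ultimately show ?thesis
    unfolding naturally_isomorphic_def id_functor_def comp_functor_def prod.case
    by (intro exI[of _ ?\<eta>]) blast
qed

end

context equivalence_span
begin

interpretation conv: equivalence_span D C P b a "\<lambda>p q g f. R p q f g"
  by (rule converse_span)

theorem equivalent_categories: "equivalent_categories C D"
proof -
  obtain s where s: "\<And>A. A \<in> Ob C \<Longrightarrow> s A \<in> P \<and> a (s A) = A"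
    using cover(1) by metis
  obtain t where t: "\<And>X. X \<in> Ob D \<Longrightarrow> t X \<in> P \<and> b (t X) = X"
    using cover(2) by metis
  \<comment> \<open>In the transposed span the two constructions change places, so its functor and
    unit are the missing second halves.\<close>
  have "conv.push = pull" "conv.pull = push"
    by (simp_all add: fun_eq_iff conv.push_def conv.pull_def push_def pull_def)
  then show ?thesis
    unfolding equivalent_categories_def
    using categories functor_push[of s, OF s] conv.functor_push[of t, OF t]
      unit_pull_push[of s t, OF s t] conv.unit_pull_push[of t s, OF t s]
    by (intro conjI exI) simp_all
qed

end

section \<open>The duality\<close>

lemma boole_ob_clop_stone: "stone_ob n X \<Longrightarrow> boole_ob n (clop X)"
  by (cases X) (auto simp: stone_ob_def boole_ob_clop)

text \<open>The spectrum has points of type \<open>'u set\<close> and so is not an object of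
  \<open>Stone_cat\<close>. A copy of it on a small set is, and its clopen algebra is reached from
  \<open>A\<close> through that of the spectrum.\<close>

lemma ex_stone_ob_small:
  assumes U: "universe U" and A: "boole_ob n A" "car (fst A) \<in> U"
  shows "\<exists>X e. stone_ob n X \<and> topspace (fst X) \<in> U \<and> boole_iso n A (clop X) e"
proof -
  obtain B J where BJ: "A = (B, J)"
    by force
  obtain X u where X: "spec (B, J) = (X, u)"
    by force
  have ob: "boole_ob n (B, J)"
    using A BJ by simp
  note B = boole_ob_alg[OF ob]
  have "topspace X = ultrafilters B"
    using topspace_spec[OF B, of J] X by simp
  then have "topspace X \<subseteq> Pow (car B)"
    using ultrafilter_sub[OF B] by blast
  moreover have "car B \<in> U"
    using A(2) BJ by simp
  ultimately obtain h where h: "inj_on h (topspace X)" "h ` topspace X \<in> U"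
    using universe_inj[OF U] by metis
  have "stone_ob n (X, u)"
    using stone_ob_spec[OF ob] X by simp
  then obtain Y v f where Y: "stone_ob n (Y, v)" "topspace Y = h ` topspace X" "top_iso n (Y, v) (X, u) f"
    by (rule stone_ob_transport[OF _ h(1)])
  have "boole_iso n (B, J) (clop (X, u)) (boole_unit (B, J))"
    using boole_iso_unit[OF ob] X by simp
  then have "boole_iso n (B, J) (clop (Y, v)) (boole_comp (B, J) (clop_map (Y, v) (X, u) f) (boole_unit (B, J)))"
    by (rule boole_iso_trans[OF ob boole_ob_clop_stone[OF Y(1)] _ boole_iso_clop_map[OF Y(3)]])
  then show ?thesis
    using Y h BJ by (intro exI[of _ "(Y, v)"] exI) simp
qed

lemma ex_boole_ob_small:
  assumes U: "universe U" and X: "stone_ob n X" "topspace (fst X) \<in> U"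
  shows "\<exists>A e. boole_ob n A \<and> car (fst A) \<in> U \<and> boole_iso n A (clop X) e"
proof -
  obtain B J where BJ: "clop X = (B, J)"
    by force
  have ob: "boole_ob n (B, J)"
    using boole_ob_clop_stone[OF X(1)] BJ by simp
  have "car B = clopens (fst X)"
    using BJ clop_simps(1)[of "fst X" "snd X"] by simp
  then have "car B \<subseteq> Pow (topspace (fst X))"
    using clopens_closed(6) by blast
  then obtain h where h: "inj_on h (car B)" "h ` car B \<in> U"
    by (rule universe_inj[OF U X(2)])
  obtain A I f where "boole_ob n (A, I)" "car A = h ` car B" "boole_iso n (A, I) (B, J) f"
    by (rule boole_ob_transport[OF ob h(1)])
  then show ?thesis
    using h BJ by (intro exI[of _ "(A, I)"] exI[of _ f]) simp
qed

text \<open>The index \<open>(A, X, e)\<close> records an isomorphism \<open>e\<close> from \<open>A\<close> to the clopen algebra of \<open>X\<close>;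
  \<open>f\<close> and \<open>g\<close> are related if \<open>f\<close> becomes the inverse image map of \<open>g\<close> under these isomorphisms.\<close>

lemma equivalence_span_Boole_Stone:
  assumes U: "universe U"
  shows "equivalence_span (Boole_cat n U) (opposite (Stone_cat n U))
    {(A, X, e). A \<in> Ob (Boole_cat n U) \<and> X \<in> Ob (Stone_cat n U) \<and> boole_iso n A (clop X) e}
    fst (\<lambda>(A, X, e). X)
    (\<lambda>(A, X, e) (A', X', e') f g. boole_comp A e' f = boole_comp A (clop_map X' X g) e)"
    (is "equivalence_span _ _ ?P _ _ ?R")
proof
  show "category (Boole_cat n U)" "category (opposite (Stone_cat n U))"
    by (rule category_Boole_cat category_opposite category_Stone_cat)+
  show "\<exists>p\<in>?P. fst p = A" if A: "A \<in> Ob (Boole_cat n U)" for A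
  proof -
    obtain X e where "stone_ob n X \<and> topspace (fst X) \<in> U \<and> boole_iso n A (clop X) e"
      using ex_stone_ob_small[OF U] A unfolding Boole_cat_simps by blast
    then show ?thesis
      using A by (intro bexI[of _ "(A, X, e)"]) (auto simp: Stone_cat_simps)
  qed
  show "\<exists>p\<in>?P. (case p of (A, X, e) \<Rightarrow> X) = X" if X: "X \<in> Ob (opposite (Stone_cat n U))" for X
  proof -
    obtain A e where "boole_ob n A \<and> car (fst A) \<in> U \<and> boole_iso n A (clop X) e"
      using ex_boole_ob_small[OF U] X unfolding Stone_cat_simps opposite_simps by blast
    then show ?thesis
      using X by (intro bexI[of _ "(A, X, e)"]) (auto simp: Boole_cat_simps opposite_simps)
  qed
next
  fix p assume p: "p \<in> ?P"
  then obtain A X e where P: "p = (A, X, e)" "boole_iso n A (clop X) e"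
    by blast
  have "clop_map X X (top_id X) = boole_id (clop X)"
    using clop_map_id by (cases X) blast
  then show "?R p p (Id (Boole_cat n U) (fst p)) (Id (opposite (Stone_cat n U)) (case p of (A, X, e) \<Rightarrow> X))"
    using boole_comp_id[of e n A "clop X"] P
    by (simp add: boole_iso_def Boole_cat_simps Stone_cat_simps opposite_simps)
next
  fix p q assume p: "p \<in> ?P" and q: "q \<in> ?P"
  obtain A X e where P: "p = (A, X, e)" "boole_iso n A (clop X) e" "stone_ob n X" "boole_ob n A"
    using p by (auto simp: Boole_cat_simps Stone_cat_simps)
  obtain A' X' e' where Q: "q = (A', X', e')" "boole_iso n A' (clop X') e'" "stone_ob n X'" "boole_ob n A'"
    using q by (auto simp: Boole_cat_simps Stone_cat_simps)
  have cX: "boole_ob n (clop X)"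
    by (rule boole_ob_clop_stone[OF P(3)])
  obtain d where e: "e \<in> boole_hom n A (clop X)" "d \<in> boole_hom n (clop X) A"
    "boole_comp A d e = boole_id A" "boole_comp (clop X) e d = boole_id (clop X)"
    using P(2) unfolding boole_iso_def by blast
  obtain d' where e': "e' \<in> boole_hom n A' (clop X')" "d' \<in> boole_hom n (clop X') A'"
    "boole_comp A' d' e' = boole_id A'" "boole_comp (clop X') e' d' = boole_id (clop X')"
    using Q(2) unfolding boole_iso_def by blast
  \<comment> \<open>An arrow from \<open>X\<close> to \<open>X'\<close> in the opposite category is
    a map from \<open>X'\<close> to \<open>X\<close>; its inverse image map runs in the same
    direction as an arrow from \<open>A\<close> to \<open>A'\<close>.\<close>
  have clop_hom: "clop_map X' X g \<in> boole_hom n (clop X) (clop X')" if "g \<in> top_hom n X' X" for g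
    using that clop_map_hom by (cases X; cases X') blast
  have faithful: "g1 = g2" if "g1 \<in> top_hom n X' X" "g2 \<in> top_hom n X' X"
    "clop_map X' X g1 = clop_map X' X g2" for g1 g2
    using that P(3) by (cases X; cases X') (metis clop_map_faithful fst_conv stone_ob_def)
  have full: "\<exists>g\<in>top_hom n X' X. clop_map X' X g = \<phi>" if "\<phi> \<in> boole_hom n (clop X) (clop X')" for \<phi>
    using that P(3) Q(3) by (cases X; cases X') (metis clop_map_full)
  show "\<exists>!g. g \<in> Hom (opposite (Stone_cat n U)) (case p of (A, X, e) \<Rightarrow> X) (case q of (A, X, e) \<Rightarrow> X)
      \<and> ?R p q f g" if "f \<in> Hom (Boole_cat n U) (fst p) (fst q)" for f
  proof -
    have f: "f \<in> boole_hom n A A'"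
      using that P(1) Q(1) by (simp add: Boole_cat_simps)
    \<comment> \<open>This is \<open>f\<close> conjugated by the two isomorphisms, with
      \<open>d\<close> the inverse of \<open>e\<close>. Fullness realises it by a map
      \<open>g\<close>, and faithfulness makes \<open>g\<close> unique.\<close>
    let ?\<phi> = "boole_comp (clop X) (boole_comp A e' f) d"
    have e'f: "boole_comp A e' f \<in> boole_hom n A (clop X')"
      by (rule boole_hom_comp[OF P(4) f e'(1)])
    then have "?\<phi> \<in> boole_hom n (clop X) (clop X')"
      by (rule boole_hom_comp[OF cX e(2)])
    then obtain g where g: "g \<in> top_hom n X' X" "clop_map X' X g = ?\<phi>"
      using full by blast
    have eq: "boole_comp A e' f = boole_comp A ?\<phi> e"
      using boole_comp_assoc[OF e(1), of "boole_comp A e' f" d] e(3) boole_comp_id(1)[OF e'f] by simp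
    have "h = g" if h: "h \<in> top_hom n X' X" "boole_comp A e' f = boole_comp A (clop_map X' X h) e" for h
    proof (rule faithful[OF h(1) g(1)])
      have "?\<phi> = clop_map X' X h"
        using h(2) boole_comp_assoc[OF e(2), of "clop_map X' X h" e] e(4)
          boole_comp_id(1)[OF clop_hom[OF h(1)]] by simp
      then show "clop_map X' X h = clop_map X' X g"
        using g(2) by simp
    qed
    then have "\<exists>!g. g \<in> top_hom n X' X \<and> boole_comp A e' f = boole_comp A (clop_map X' X g) e"
      using g eq by metis
    then show ?thesis
      using P(1) Q(1) by (simp add: opposite_simps Stone_cat_simps)
  qed
  show "\<exists>!f. f \<in> Hom (Boole_cat n U) (fst p) (fst q) \<and> ?R p q f g"
    if "g \<in> Hom (opposite (Stone_cat n U)) (case p of (A, X, e) \<Rightarrow> X) (case q of (A, X, e) \<Rightarrow> X)" for g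
  proof -
    have g: "g \<in> top_hom n X' X"
      using that P(1) Q(1) by (simp add: opposite_simps Stone_cat_simps)
    \<comment> \<open>Here the relation is solved for \<open>f\<close> by cancelling
      \<open>e'\<close> with its inverse \<open>d'\<close>.\<close>
    let ?\<psi> = "boole_comp A (clop_map X' X g) e"
    have \<psi>: "?\<psi> \<in> boole_hom n A (clop X')"
      by (rule boole_hom_comp[OF P(4) e(1) clop_hom[OF g]])
    have f: "boole_comp A d' ?\<psi> \<in> boole_hom n A A'"
      by (rule boole_hom_comp[OF P(4) \<psi> e'(2)])
    have "boole_comp A e' (boole_comp A d' ?\<psi>) = ?\<psi>"
      using boole_comp_assoc[OF \<psi>, of e' d'] e'(4) boole_comp_id(2)[OF \<psi>] by simp
    moreover have "h = boole_comp A d' ?\<psi>" if h: "h \<in> boole_hom n A A'" "boole_comp A e' h = ?\<psi>" for h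
      using boole_comp_assoc[OF h(1), of d' e'] e'(3) boole_comp_id(2)[OF h(1)] h(2) by simp
    ultimately have "\<exists>!f. f \<in> boole_hom n A A' \<and> boole_comp A e' f = ?\<psi>"
      using f by metis
    then show ?thesis
      using P(1) Q(1) by (simp add: Boole_cat_simps)
  qed
next
  fix p q r f g f' g'
  assume p: "p \<in> ?P" and q: "q \<in> ?P" and r: "r \<in> ?P"
    and hom: "f \<in> Hom (Boole_cat n U) (fst p) (fst q)" "f' \<in> Hom (Boole_cat n U) (fst q) (fst r)"
    "g \<in> Hom (opposite (Stone_cat n U)) (case p of (A, X, e) \<Rightarrow> X) (case q of (A, X, e) \<Rightarrow> X)"
    "g' \<in> Hom (opposite (Stone_cat n U)) (case q of (A, X, e) \<Rightarrow> X) (case r of (A, X, e) \<Rightarrow> X)"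
    and rel: "?R p q f g" "?R q r f' g'"
  obtain A X e where P: "p = (A, X, e)" "boole_iso n A (clop X) e"
    using p by blast
  obtain A' X' e' where Q: "q = (A', X', e')"
    using q by blast
  obtain A'' X'' e'' where R: "r = (A'', X'', e'')"
    using r by blast
  have f: "f \<in> boole_hom n A A'" and g: "g \<in> top_hom n X' X" "g' \<in> top_hom n X'' X'"
    using hom P(1) Q R by (simp_all add: Boole_cat_simps opposite_simps Stone_cat_simps)
  have eq: "boole_comp A e' f = boole_comp A (clop_map X' X g) e"
    "boole_comp A' e'' f' = boole_comp A' (clop_map X'' X' g') e'"
    using rel P(1) Q R by simp_all
  have e: "e \<in> boole_hom n A (clop X)"
    using P(2) by (simp add: boole_iso_def)
  \<comment> \<open>The two commuting squares given by \<open>rel\<close> are pasted along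
    \<open>e'\<close>.\<close>
  have "boole_comp A e'' (boole_comp A f' f) = boole_comp A (boole_comp A' e'' f') f"
    using boole_comp_assoc[OF f] by metis
  also have "\<dots> = boole_comp A (clop_map X'' X' g') (boole_comp A (clop_map X' X g) e)"
    using eq boole_comp_assoc[OF f] by metis
  also have "\<dots> = boole_comp A (boole_comp (clop X) (clop_map X'' X' g') (clop_map X' X g)) e"
    using boole_comp_assoc[OF e] by metis
  also have "boole_comp (clop X) (clop_map X'' X' g') (clop_map X' X g) = clop_map X'' X (top_comp X'' g g')"
    using g by (cases X; cases X'; cases X'') (metis clop_map_comp)
  finally show "?R p r (Comp (Boole_cat n U) (fst p) (fst q) (fst r) f' f)
    (Comp (opposite (Stone_cat n U)) (case p of (A, X, e) \<Rightarrow> X) (case q of (A, X, e) \<Rightarrow> X)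
      (case r of (A, X, e) \<Rightarrow> X) g' g)"
    using P(1) Q R by (simp add: Boole_cat_simps opposite_simps Stone_cat_simps)
qed (auto simp: opposite_simps)

lemma dual_Boole_Stone:
  assumes "universe U"
  shows "dual_categories (Boole_cat n U) (Stone_cat n U)"
  unfolding dual_categories_def
  by (rule equivalence_span.equivalent_categories[OF equivalence_span_Boole_Stone[OF assms]])

theorem theorem6p4:
  fixes n :: nat
  assumes "n \<ge> 1"
  shows
    "(\<forall>U :: 'u set set. universe U \<longrightarrow> dual_categories (Boole_cat n U) (Stone_cat n U))
   \<and>
     (\<comment> \<open>contravariant functor from Boole to Stone\<close>
      (\<forall>A :: 'a boole. boole_ob n A \<longrightarrow>
         stone_ob n (spec A) \<and> spec_map A A (boole_id A) = top_id (spec A)) \<and>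
      (\<forall>(A :: 'a boole) (B :: 'b boole). \<forall>f\<in>boole_hom n A B.
         boole_ob n A \<longrightarrow> boole_ob n B \<longrightarrow> spec_map A B f \<in> top_hom n (spec B) (spec A)) \<and>
      (\<forall>(A :: 'a boole) (B :: 'b boole) (C :: 'c boole). \<forall>f\<in>boole_hom n A B. \<forall>g\<in>boole_hom n B C.
         boole_ob n A \<longrightarrow> boole_ob n B \<longrightarrow> boole_ob n C \<longrightarrow>
         spec_map A C (boole_comp A g f) = top_comp (spec C) (spec_map A B f) (spec_map B C g)))
   \<and>
     (\<comment> \<open>contravariant functor from Stone to Boole\<close>
      (\<forall>X :: 'x topn. stone_ob n X \<longrightarrow>
         boole_ob n (clop X) \<and> clop_map X X (top_id X) = boole_id (clop X)) \<and>
      (\<forall>(X :: 'x topn) (Y :: 'y topn). \<forall>f\<in>top_hom n X Y.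
         stone_ob n X \<longrightarrow> stone_ob n Y \<longrightarrow> clop_map X Y f \<in> boole_hom n (clop Y) (clop X)) \<and>
      (\<forall>(X :: 'x topn) (Y :: 'y topn) (Z :: 'z topn). \<forall>f\<in>top_hom n X Y. \<forall>g\<in>top_hom n Y Z.
         stone_ob n X \<longrightarrow> stone_ob n Y \<longrightarrow> stone_ob n Z \<longrightarrow>
         clop_map X Z (top_comp X g f) = boole_comp (clop Z) (clop_map X Y f) (clop_map Y Z g)))
   \<and>
     (\<comment> \<open>natural isomorphism from the identity of Boole\<close>
      (\<forall>A :: 'a boole. boole_ob n A \<longrightarrow> boole_iso n A (clop (spec A)) (boole_unit A)) \<and>
      (\<forall>(A :: 'a boole) (B :: 'b boole). \<forall>f\<in>boole_hom n A B.
         boole_ob n A \<longrightarrow> boole_ob n B \<longrightarrow>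
         boole_comp A (boole_unit B) f =
         boole_comp A (clop_map (spec B) (spec A) (spec_map A B f)) (boole_unit A)))
   \<and>
     (\<comment> \<open>natural isomorphism from the identity of Stone\<close>
      (\<forall>X :: 'x topn. stone_ob n X \<longrightarrow> top_iso n X (spec (clop X)) (stone_unit X)) \<and>
      (\<forall>(X :: 'x topn) (Y :: 'y topn). \<forall>f\<in>top_hom n X Y.
         stone_ob n X \<longrightarrow> stone_ob n Y \<longrightarrow>
         top_comp X (stone_unit Y) f =
         top_comp X (spec_map (clop Y) (clop X) (clop_map X Y f)) (stone_unit X)))"
  \<comment> \<open>The functor and unit lemmas are mostly stated for explicit pairs, so quantifiers
    over objects are split into their components.\<close>
  unfolding split_paired_All
  by (intro conjI allI impI ballI;
      (rule dual_Boole_Stone stone_ob_spec spec_map_id spec_map_hom spec_map_comp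
        boole_ob_clop_stone clop_map_id clop_map_hom clop_map_comp
        boole_iso_unit boole_unit_natural top_iso_unit stone_unit_natural; assumption))

end
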